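(* Let $(Q_d)_{d\ge1}$ be a sequence of real polynomials, $Q_d$ having $m_d$ variables and degree $q_d$, such that for every $d\ge 1$ $$\max\{|Q_d(x)|: x\in I^{m_d}\}\ge1.$$ Then for any $p\in\,]0,1[$ there exists a set $E_p\subset I^\infty$ of measure $p$ such that for any $f\in E_p$ and any $d\ge1$, $$|Q_d(f)|\ge\left(\frac{3(1-p)}{2\pi^2d^2m_d}\right)^{q_d}.$$ In particular, if $q_d\le d^{\kappa_1}$ and $m_d\le d^{\kappa_2}$ for all $d\ge 1$, for some $\kappa_1,\kappa_2\ge0$, then with probability at least $p$ one has, for all $d\ge1$, $$|Q_d(f)|\ge e^{-(\gamma_p+\kappa_2)d^{\kappa_1+1}},$$ where $\gamma_p$ is a constant depending only on $p$ which goes to $+\infty$ as $p$ goes to $1$.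
   Context: $I=[-1,1]\subset\mathbb{R}$; $I^\infty$ is the set of sequences $(a_k)_{k\ge0}$ with $a_k\in I$, equipped with the product probability measure $\mu$ of the normalized Lebesgue (probability) measures on the factors $I$; equivalently, the $\mu$-measure of a cylinder $\pi_n^{-1}(G)$, for $\pi_n:I^\infty\to I^n$ the projection on the first $n$ coordinates and $G\subset I^n$ measurable, is the normalized Lebesgue measure $\mu_n(G)$. A sequence $(a_k)_{k\ge0}\in I^\infty$ is identified with the analytic function $f(z)=\sum_{k\ge0}a_kz^k$, convergent at least for $|z|<1$. For a polynomial $Q$ in $m$ variables and $f=(a_k)_{k\ge0}\in I^\infty$, $Q(f)$ denotes $Q(a_0,\dots,a_{m-1})$. "With probability at least $p$" refers to $\mu$. *)

theory Defs
  imports "HOL-Probability.Probability" "HOL-Library.Poly_Mapping"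
begin

text \<open>
  Real polynomials in the variables \<open>X\<^sub>0, X\<^sub>1, \<dots>\<close>: a monomial is a finitely supported exponent
  vector, a polynomial a finitely supported family of coefficients. With the convolution product
  of \<open>Poly_Mapping\<close> this type is the ring of polynomials over the reals in these variables.
\<close>

type_synonym mpoly = "(nat \<Rightarrow>\<^sub>0 nat) \<Rightarrow>\<^sub>0 real"

definition mpoly_vars :: "mpoly \<Rightarrow> nat set" where
  "mpoly_vars P = (\<Union>k\<in>Poly_Mapping.keys P. Poly_Mapping.keys k)"

definition monom_degree :: "(nat \<Rightarrow>\<^sub>0 nat) \<Rightarrow> nat" where
  "monom_degree k = (\<Sum>i\<in>Poly_Mapping.keys k. Poly_Mapping.lookup k i)"

text \<open>Total degree; the zero polynomial is given degree 0.\<close>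

definition mpoly_degree :: "mpoly \<Rightarrow> nat" where
  "mpoly_degree P = Max (insert 0 (monom_degree ` Poly_Mapping.keys P))"

text \<open>
  The point of evaluation is a whole sequence, but only its entries at the indices in
  \<open>mpoly_vars P\<close> matter. So one function serves both for points of \<open>I\<^sup>m\<close> (extensional functions
  on \<open>{..<m}\<close>) and for \<open>Q(f) = Q(a\<^sub>0, \<dots>, a\<^bsub>m-1\<^esub>)\<close> with a sequence \<open>f = (a\<^sub>k)\<close>.
\<close>

definition mpoly_eval :: "mpoly \<Rightarrow> (nat \<Rightarrow> real) \<Rightarrow> real" where
  "mpoly_eval P x =
    (\<Sum>k\<in>Poly_Mapping.keys P. Poly_Mapping.lookup P k *
      (\<Prod>i\<in>Poly_Mapping.keys k. x i ^ Poly_Mapping.lookup k i))"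

lemma mpoly_eval_cong:
  assumes "\<And>i. i \<in> mpoly_vars P \<Longrightarrow> x i = y i"
  shows "mpoly_eval P x = mpoly_eval P y"
proof -
  have "x i = y i" if "k \<in> Poly_Mapping.keys P" "i \<in> Poly_Mapping.keys k" for k i
    using assms[of i] that by (auto simp: mpoly_vars_def)
  then show ?thesis
    by (simp add: mpoly_eval_def cong: sum.cong prod.cong)
qed

definition sym_interval :: "real set" where
  "sym_interval = {-1..1}"

definition cube :: "nat \<Rightarrow> (nat \<Rightarrow> real) set" where
  "cube m = {..<m} \<rightarrow>\<^sub>E sym_interval"

text \<open>Normalised Lebesgue measure on \<open>[-1,1]\<close>, as a measure whose space is \<open>[-1,1]\<close> itself.\<close>

definition interval_measure :: "real measure" where
  "interval_measure = uniform_measure (restrict_space lborel sym_interval) sym_interval"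

definition seq_measure :: "(nat \<Rightarrow> real) measure" where
  "seq_measure = (\<Pi>\<^sub>M k\<in>UNIV. interval_measure)"

lemma space_interval_measure: "space interval_measure = sym_interval"
  by (simp add: interval_measure_def space_restrict_space)

lemma space_seq_measure: "space seq_measure = {f. \<forall>k. f k \<in> sym_interval}"
  by (auto simp: seq_measure_def space_PiM space_interval_measure PiE_def)

lemma prob_space_interval_measure: "prob_space interval_measure"
  unfolding interval_measure_def
  by (rule prob_space_uniform_measure)
     (simp_all add: emeasure_restrict_space sym_interval_def)

lemma prob_space_seq_measure: "prob_space seq_measure"
  unfolding seq_measure_def by (intro prob_space_PiM prob_space_interval_measure)

text \<open>
  The standing hypothesis on \<open>(Q\<^sub>d)\<^bsub>d\<ge>1\<^esub>\<close>. The supremum is a maximum, since the cube is compact.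
  The case \<open>m d = 0\<close>, in which \<open>Q d\<close> is constant, is not excluded.
\<close>

definition normalized_family ::
    "(nat \<Rightarrow> mpoly) \<Rightarrow> (nat \<Rightarrow> nat) \<Rightarrow> (nat \<Rightarrow> nat) \<Rightarrow> bool" where
  "normalized_family Q m q \<longleftrightarrow>
    (\<forall>d\<ge>1. mpoly_vars (Q d) \<subseteq> {..<m d} \<and> mpoly_degree (Q d) = q d \<and>
            (SUP x\<in>cube (m d). \<bar>mpoly_eval (Q d) x\<bar>) \<ge> 1)"

end

(*
  A univariate polynomial R of degree at most n with |R(0)| > 1/2 satisfies
  |R| <= e^n only on a subset of [0, L] of measure at most 4 e L (Remez): otherwise one finds n + 1
  points of that set, spaced at least like Chebyshev nodes on an interval of length 4 e L, and
  Lagrange interpolation at these points bounds |R(0)| by 1/2. Applying this on every ray issuing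
  from a point c of the cube with |Q(c)| > 1/2 and integrating in polar coordinates around c shows
  that {|Q| <= e^q} has normalized measure at most 4 m e. With e = 3(1-p)/(2 pi^2 d^2 m_d) these
  measures sum to at most 1 - p, as the inverse squares sum to pi^2/6. Finally the remaining set is
  cut down to measure exactly p by a condition a_0 <= a, whose measure is continuous in a.
*)
theory Submission
  imports Defs "HOL-Computational_Algebra.Polynomial"
begin

text \<open>The volume bound has to be linear in m and free of the degree. Each line used must
  therefore pass through a point where |Q| is known to be large, and only c offers this. On a ray of
  length L from c, Remez leaves a set of length at most 4 e L; the radial density m t^(m-1) is at
  most m L^(m-1) there, so the set weighs at most 4 m e L^m, against L^m for the whole ray. The
  ratio is the same in all directions, although L is not. The threshold 1/2 is exactly what
  interpolation yields: points of [0, L] that are spread like Chebyshev nodes scaled by h = 2 e L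
  give |R(0)| <= e^n (L/h)^n 2^(n-1) = 1/2, where 2^(n-1) is the leading coefficient of the
  Chebyshev polynomial of degree n. In degree zero the set {|Q| <= e^0} may be the whole cube, so
  constants are treated directly.\<close>

section \<open>Lagrange interpolation at n + 1 nodes\<close>

definition lagrange_basis :: "(nat \<Rightarrow> 'a::field) \<Rightarrow> nat \<Rightarrow> nat \<Rightarrow> 'a poly" where
  "lagrange_basis x n j = (\<Prod>i\<in>{..n} - {j}. smult (inverse (x j - x i)) [:- x i, 1:])"

lemma poly_lagrange_basis:
  "poly (lagrange_basis x n j) y = (\<Prod>i\<in>{..n} - {j}. (y - x i) / (x j - x i))"
  unfolding lagrange_basis_def poly_prod
  by (intro prod.cong) (simp_all add: divide_inverse left_diff_distrib mult.commute[of "inverse _"])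

lemma degree_lagrange_basis:
  assumes "j \<le> n"
  shows "degree (lagrange_basis x n j) \<le> n"
proof -
  have "degree (lagrange_basis x n j)
      \<le> (\<Sum>i\<in>{..n} - {j}. degree (smult (inverse (x j - x i)) [:- x i, 1:]))"
    unfolding lagrange_basis_def
    using degree_prod_sum_le[of "{..n} - {j}" "\<lambda>i. smult (inverse (x j - x i)) [:- x i, 1:]"]
    by (simp add: o_def)
  also have "\<dots> \<le> (\<Sum>i\<in>{..n} - {j}. 1)"
    by (intro sum_mono) (simp add: degree_smult_le)
  also have "\<dots> = n" using assms by simp
  finally show ?thesis .
qed

text \<open>The index is \<open>card A\<close> instead of the degree, so factors with
  \<open>c i = 0\<close> need no separate case.\<close>

lemma coeff_prod_linear:
  "finite A \<Longrightarrow> coeff (\<Prod>i\<in>A. smult (c i) [:- x i, 1:]) (card A) = (\<Prod>i\<in>A. c i :: 'a::field)"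
proof (induction A rule: finite_induct)
  case (insert a A)
  have "degree (\<Prod>i\<in>A. smult (c i) [:- x i, 1:]) \<le> (\<Sum>i\<in>A. degree (smult (c i) [:- x i, 1:]))"
    using degree_prod_sum_le[of A "\<lambda>i. smult (c i) [:- x i, 1:]"] insert by (simp add: o_def)
  also have "\<dots> \<le> (\<Sum>i\<in>A. 1)"
    by (intro sum_mono) (simp add: degree_smult_le)
  finally have "coeff (\<Prod>i\<in>A. smult (c i) [:- x i, 1:]) (Suc (card A)) = 0"
    by (intro coeff_eq_0) simp
  with insert show ?case by (simp add: algebra_simps)
qed simp

lemma coeff_lagrange_basis:
  assumes "j \<le> n"
  shows "coeff (lagrange_basis x n j) n = (\<Prod>i\<in>{..n} - {j}. inverse (x j - x i))"
  using coeff_prod_linear[of "{..n} - {j}" "\<lambda>i. inverse (x j - x i)" x] assms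
  by (simp add: lagrange_basis_def)

text \<open>Both sides have degree at most \<open>n\<close> and agree at \<open>n + 1\<close>
  distinct points.\<close>

lemma lagrange_interpolation:
  fixes x :: "nat \<Rightarrow> 'a::field"
  assumes "inj_on x {..n}" "degree P \<le> n"
  shows "P = (\<Sum>j\<le>n. smult (poly P (x j)) (lagrange_basis x n j))"
proof (rule poly_eqI_degree[where A = "x ` {..n}"])
  fix y assume "y \<in> x ` {..n}"
  then obtain k where k: "k \<le> n" "y = x k" by auto
  have "poly (lagrange_basis x n j) (x k) = (if j = k then 1 else 0)" if "j \<le> n" for j
  proof (cases "j = k")
    case True
    have "(x k - x i) / (x k - x i) = 1" if "i \<in> {..n} - {k}" for i
      using that assms(1) k by (auto simp: inj_on_def)
    then show ?thesis using True by (simp add: poly_lagrange_basis)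
  next
    case False
    then have "\<exists>i\<in>{..n} - {j}. (x k - x i) / (x j - x i) = 0" using k by auto
    then show ?thesis using False by (simp add: poly_lagrange_basis)
  qed
  then have "poly (\<Sum>j\<le>n. smult (poly P (x j)) (lagrange_basis x n j)) y
     = (\<Sum>j\<le>n. poly P (x j) * (if j = k then 1 else 0))"
    by (simp add: poly_sum k)
  also have "\<dots> = poly P y" using k by (simp add: if_distrib cong: if_cong)
  finally show "poly P y = poly (\<Sum>j\<le>n. smult (poly P (x j)) (lagrange_basis x n j)) y" ..
next
  show "degree P < card (x ` {..n})" using assms by (simp add: card_image)
  have "degree (\<Sum>j\<le>n. smult (poly P (x j)) (lagrange_basis x n j)) \<le> n"
    by (intro degree_sum_le) (auto intro: order.trans[OF degree_smult_le] degree_lagrange_basis)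
  then show "degree (\<Sum>j\<le>n. smult (poly P (x j)) (lagrange_basis x n j)) < card (x ` {..n})"
    using assms by (simp add: card_image)
qed

section \<open>Chebyshev polynomials of the first kind and their extremal points\<close>

fun chebyshev :: "nat \<Rightarrow> real poly" where
  "chebyshev 0 = 1"
| "chebyshev (Suc 0) = [:0, 1:]"
| "chebyshev (Suc (Suc n)) = [:0, 2:] * chebyshev (Suc n) - chebyshev n"

lemma poly_chebyshev_cos: "poly (chebyshev n) (cos t) = cos (real n * t)"
proof (induction n rule: chebyshev.induct)
  case (3 n)
  have "cos (real (Suc (Suc n)) * t) + cos (real n * t) = 2 * cos t * cos (real (Suc n) * t)"
    using cos_plus_cos[of "real (Suc (Suc n)) * t" "real n * t"]
    by (simp add: algebra_simps add_divide_distrib)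
  then show ?case using 3 by (simp add: algebra_simps)
qed auto

lemma degree_chebyshev: "degree (chebyshev n) \<le> n"
proof (induction n rule: chebyshev.induct)
  case (3 n)
  have "degree ([:0, 2:] * chebyshev (Suc n)) \<le> Suc (Suc n)"
    using degree_mult_le[of "[:0, 2:]" "chebyshev (Suc n)"] 3 by simp
  then show ?case using 3 by (simp add: degree_diff_le)
qed auto

lemma coeff_chebyshev: "coeff (chebyshev (Suc n)) (Suc n) = 2 ^ n"
proof (induction n)
  case (Suc n)
  have "coeff (chebyshev n) (Suc (Suc n)) = 0"
    using degree_chebyshev[of n] by (intro coeff_eq_0) simp
  with Suc show ?case by (simp del: One_nat_def)
qed simp

text \<open>These are the extremal points of the Chebyshev polynomial on [-1,1], not its zeros. The
  minus sign makes them increase with \<open>j\<close>, from -1 at \<open>j = 0\<close> to 1 at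
  \<open>j = n\<close> when \<open>n\<close> is positive.\<close>

definition cheb_node :: "nat \<Rightarrow> nat \<Rightarrow> real" where
  "cheb_node n j = - cos (real j * pi / real n)"

lemma cheb_node_mono:
  assumes "i < j" "j \<le> n"
  shows "cheb_node n i < cheb_node n j"
  unfolding cheb_node_def using assms
  by (auto intro!: cos_monotone_0_pi divide_strict_right_mono simp: divide_le_eq)

lemma inj_on_cheb_node: "inj_on (cheb_node n) {..n}"
  by (rule linorder_inj_onI) (auto dest: cheb_node_mono)

lemma cheb_node_bounds: "-1 \<le> cheb_node n j" "cheb_node n j \<le> 1"
  by (simp_all add: cheb_node_def)

text \<open>Exactly the \<open>n - j\<close> factors with \<open>i > j\<close> are negative.\<close>

lemma sign_prod_increasing:
  fixes x :: "nat \<Rightarrow> real"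
  assumes "\<And>i k. i < k \<Longrightarrow> k \<le> n \<Longrightarrow> x i < x k" "j \<le> n"
  shows "(-1) ^ (n - j) * (\<Prod>i\<in>{..n} - {j}. inverse (x j - x i))
    = (\<Prod>i\<in>{..n} - {j}. inverse \<bar>x j - x i\<bar>)"
proof -
  have split: "{..n} - {j} = {..<j} \<union> {j<..n}" using assms(2) by auto
  have neg: "inverse \<bar>x j - x i\<bar> = (-1) * inverse (x j - x i)" if "i \<in> {j<..n}" for i
    using assms(1)[of j i] that by (simp add: abs_if flip: inverse_minus_eq)
  have "(\<Prod>i\<in>{j<..n}. inverse \<bar>x j - x i\<bar>) = (\<Prod>i\<in>{j<..n}. (-1) * inverse (x j - x i))"
    by (intro prod.cong refl neg)
  also have "\<dots> = (-1) ^ (n - j) * (\<Prod>i\<in>{j<..n}. inverse (x j - x i))"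
    by (subst prod.distrib) simp
  finally have 1: "(\<Prod>i\<in>{j<..n}. inverse \<bar>x j - x i\<bar>)
    = (-1) ^ (n - j) * (\<Prod>i\<in>{j<..n}. inverse (x j - x i))" .
  have pos: "\<bar>x j - x i\<bar> = x j - x i" if "i \<in> {..<j}" for i
    using assms(1)[of i j] assms(2) that by simp
  have 2: "(\<Prod>i\<in>{..<j}. inverse \<bar>x j - x i\<bar>) = (\<Prod>i\<in>{..<j}. inverse (x j - x i))"
    by (intro prod.cong refl) (simp add: pos)
  have "finite {..<j}" "finite {j<..n}" "{..<j} \<inter> {j<..n} = {}" by auto
  note un = prod.union_disjoint[OF this]
  show ?thesis
    unfolding split un by (simp only: 1 2 mult_ac)
qed

text \<open>
  Since the Chebyshev polynomial takes the values \<open>\<plusminus>1\<close> at the nodes with the alternating signs of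
  the Lagrange weights, the sum of the absolute weights is its leading coefficient.
\<close>

lemma sum_cheb_node_weights:
  "(\<Sum>j\<le>Suc n. \<Prod>i\<in>{..Suc n} - {j}. inverse \<bar>cheb_node (Suc n) j - cheb_node (Suc n) i\<bar>) = 2 ^ n"
proof -
  define N where "N = Suc n"
  let ?x = "cheb_node N"
  have val: "poly (chebyshev N) (?x j) = (-1) ^ (N - j)" if "j \<le> N" for j
  proof -
    have "?x j = cos (real (N - j) * pi / real N)"
    proof -
      have "real (N - j) * pi / real N = pi - real j * pi / real N"
        using that by (simp add: of_nat_diff N_def field_simps)
      then show ?thesis by (simp add: cheb_node_def)
    qed
    then have "poly (chebyshev N) (?x j) = cos (real (N - j) * pi)"
      by (simp add: poly_chebyshev_cos N_def)
    then show ?thesis by (simp add: cos_npi)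
  qed
  have "2 ^ n = coeff (chebyshev N) N" by (simp only: coeff_chebyshev N_def)
  also have "\<dots> = coeff (\<Sum>j\<le>N. smult (poly (chebyshev N) (?x j)) (lagrange_basis ?x N j)) N"
    by (subst lagrange_interpolation[OF inj_on_cheb_node degree_chebyshev]) (rule refl)
  also have "\<dots> = (\<Sum>j\<le>N. poly (chebyshev N) (?x j) * (\<Prod>i\<in>{..N} - {j}. inverse (?x j - ?x i)))"
    by (simp add: coeff_sum coeff_lagrange_basis)
  also have "\<dots> = (\<Sum>j\<le>N. \<Prod>i\<in>{..N} - {j}. inverse \<bar>?x j - ?x i\<bar>)"
    using sign_prod_increasing[of N ?x] cheb_node_mono[of _ _ N] by (intro sum.cong refl) (simp add: val)
  finally show ?thesis by (simp add: N_def)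
qed

text \<open>In the Lagrange formula evaluated at 0, each factor
  \<open>\<bar>t i\<bar> / \<bar>t j - t i\<bar>\<close> is at most L/h times the inverse distance
  of the corresponding Chebyshev nodes. What remains is the sum of the absolute Chebyshev weights,
  which is \<open>2 ^ n\<close>.\<close>

lemma abs_poly_0_le_cheb_spread:
  fixes t :: "nat \<Rightarrow> real"
  assumes deg: "degree P \<le> Suc n" and h: "0 < h" and s: "0 \<le> s"
    and t: "\<And>j. j \<le> Suc n \<Longrightarrow> \<bar>t j\<bar> \<le> L"
    and sp: "\<And>i j. i \<le> Suc n \<Longrightarrow> j \<le> Suc n \<Longrightarrow>
      h * \<bar>cheb_node (Suc n) j - cheb_node (Suc n) i\<bar> \<le> \<bar>t j - t i\<bar>"
    and P: "\<And>j. j \<le> Suc n \<Longrightarrow> \<bar>poly P (t j)\<bar> \<le> s"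
  shows "\<bar>poly P 0\<bar> \<le> s * (L / h) ^ Suc n * 2 ^ n"
proof -
  let ?x = "cheb_node (Suc n)" and ?N = "Suc n"
  have L: "0 \<le> L" using t[of 0] by simp
  have ne: "0 < \<bar>?x j - ?x i\<bar>" if "i \<le> ?N" "j \<le> ?N" "i \<noteq> j" for i j
    using inj_on_cheb_node[of ?N] that by (auto simp: inj_on_def)
  have inj: "inj_on t {..?N}"
  proof (rule inj_onI, rule ccontr)
    fix i j assume *: "i \<in> {..?N}" "j \<in> {..?N}" "t i = t j" "i \<noteq> j"
    have "0 < h * \<bar>?x j - ?x i\<bar>" using h ne[of i j] * by simp
    then show False using sp[of i j] * by simp
  qed
  have "\<bar>poly P 0\<bar> = \<bar>\<Sum>j\<le>?N. poly P (t j) * poly (lagrange_basis t ?N j) 0\<bar>"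
    by (subst lagrange_interpolation[OF inj deg]) (simp only: poly_sum poly_smult)
  also have "\<dots> \<le> (\<Sum>j\<le>?N. \<bar>poly P (t j) * poly (lagrange_basis t ?N j) 0\<bar>)"
    by (rule sum_abs)
  also have "\<dots> \<le> (\<Sum>j\<le>?N. s * ((L / h) ^ ?N * (\<Prod>i\<in>{..?N} - {j}. inverse \<bar>?x j - ?x i\<bar>)))"
  proof (rule sum_mono)
    fix j assume "j \<in> {..?N}"
    then have j: "j \<le> ?N" by simp
    have "\<bar>poly (lagrange_basis t ?N j) 0\<bar> = (\<Prod>i\<in>{..?N} - {j}. \<bar>t i\<bar> / \<bar>t j - t i\<bar>)"
      by (simp add: poly_lagrange_basis abs_prod)
    also have "\<dots> \<le> (\<Prod>i\<in>{..?N} - {j}. (L / h) * inverse \<bar>?x j - ?x i\<bar>)"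
    proof (rule prod_mono, intro conjI)
      fix i assume "i \<in> {..?N} - {j}"
      then have i: "i \<le> ?N" "i \<noteq> j" by auto
      have pos: "0 < h * \<bar>?x j - ?x i\<bar>" using h ne[of i j] i j by simp
      have "\<bar>t i\<bar> / \<bar>t j - t i\<bar> \<le> L / (h * \<bar>?x j - ?x i\<bar>)"
        using t[of i] sp[of i j] i j pos L by (intro frac_le) auto
      then show "\<bar>t i\<bar> / \<bar>t j - t i\<bar> \<le> (L / h) * inverse \<bar>?x j - ?x i\<bar>"
        by (simp add: divide_inverse mult_ac)
    qed simp
    also have "\<dots> = (L / h) ^ ?N * (\<Prod>i\<in>{..?N} - {j}. inverse \<bar>?x j - ?x i\<bar>)"
    proof -
      have "card ({..?N} - {j}) = ?N" using j by simp
      then show ?thesis by (simp only: prod.distrib prod_constant)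
    qed
    finally show "\<bar>poly P (t j) * poly (lagrange_basis t ?N j) 0\<bar>
      \<le> s * ((L / h) ^ ?N * (\<Prod>i\<in>{..?N} - {j}. inverse \<bar>?x j - ?x i\<bar>))"
      unfolding abs_mult using P[OF j] s by (intro mult_mono) auto
  qed
  also have "\<dots> = s * (L / h) ^ ?N * 2 ^ n"
    by (simp only: sum_distrib_left[symmetric] sum_cheb_node_weights mult.assoc)
  finally show ?thesis .
qed

section \<open>The Remez-type estimate on an interval\<close>

text \<open>The distribution function of \<open>T\<close> is 1-Lipschitz. This gives its continuity,
  and it turns a difference of levels into a distance of points.\<close>

lemma measure_Int_atMost_diff_le:
  fixes s t :: real
  assumes "T \<in> sets lborel" "T \<subseteq> {a..b}" "s \<le> t"
  shows "measure lborel (T \<inter> {..t}) \<le> measure lborel (T \<inter> {..s}) + (t - s)"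
proof -
  have Icc: "{x..y} \<in> fmeasurable lborel" for x y :: real
    by (cases "x \<le> y") (auto simp: fmeasurable_def)
  have "T \<inter> {..s} \<in> fmeasurable lborel"
    by (rule fmeasurableI2[OF Icc[of a b]]) (use assms in auto)
  then have "(T \<inter> {..s}) \<union> {s..t} \<in> fmeasurable lborel" using Icc by (rule fmeasurable.Un)
  then have "measure lborel (T \<inter> {..t}) \<le> measure lborel ((T \<inter> {..s}) \<union> {s..t})"
    by (intro measure_mono_fmeasurable) (use assms in auto)
  also have "\<dots> \<le> measure lborel (T \<inter> {..s}) + measure lborel {s..t}"
    using assms by (intro measure_Un_le) auto
  finally show ?thesis using assms by simp
qed

text \<open>The point is the last one at which the distribution function \<open>F\<close> of
  \<open>T\<close> is at most \<open>v\<close>. Continuity gives equality there, and the point lies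
  in \<open>T\<close> because \<open>F\<close> is constant to the right of a point outside the
  closed set \<open>T\<close>.\<close>

lemma compact_measure_level_point:
  fixes T :: "real set"
  assumes T: "compact T" "T \<subseteq> {0..L}" and v: "0 \<le> v" "v < measure lborel T"
  obtains t where "t \<in> T" "measure lborel (T \<inter> {..t}) = v"
proof -
  define F where "F t = measure lborel (T \<inter> {..t})" for t
  define S where "S = {t. F t \<le> v}"
  have Ts: "T \<in> sets lborel" using T(1) by (auto intro: borel_compact)
  have Fdiff: "F t \<le> F s + (t - s)" if "s \<le> t" for s t
    unfolding F_def by (rule measure_Int_atMost_diff_le[OF Ts T(2) that])
  have fin: "T \<in> fmeasurable lborel"
    using Ts emeasure_compact_finite[OF T(1)] by (simp add: fmeasurable_def)
  have Fmono: "F s \<le> F t" if "s \<le> t" for s t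
    unfolding F_def
    by (rule measure_mono_fmeasurable) (use Ts that fin in \<open>auto intro: fmeasurable_Int_fmeasurable\<close>)
  have "F 0 \<le> measure lborel {0::real}"
    unfolding F_def by (rule measure_mono_fmeasurable) (use T(2) Ts in \<open>auto simp: fmeasurable_def\<close>)
  then have S0: "0 \<in> S" using v by (simp add: S_def)
  have bdd: "t \<le> L" if "t \<in> S" for t
  proof (rule ccontr)
    assume "\<not> t \<le> L"
    then have "T \<inter> {..t} = T" using T(2) by auto
    then show False using that v by (simp add: S_def F_def)
  qed
  then have bS: "bdd_above S" by (auto simp: bdd_above_def)
  define \<tau> where "\<tau> = Sup S"
  have gt: "v < F t" if "\<tau> < t" for t
  proof (rule ccontr)
    assume "\<not> v < F t"
    then have "t \<in> S" by (simp add: S_def)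
    then have "t \<le> \<tau>" unfolding \<tau>_def using bS by (rule cSup_upper)
    with that show False by simp
  qed
  \<comment> \<open>Both inequalities use the Lipschitz bound: here against points of
    \<open>S\<close> just below \<open>\<tau>\<close>, and for \<open>ge\<close> against points just
    above, where \<open>F\<close> exceeds \<open>v\<close>.\<close>
  have le: "F \<tau> \<le> v"
  proof (rule field_le_epsilon)
    fix e :: real assume "0 < e"
    then obtain t where t: "t \<in> S" "\<tau> - e < t"
      using less_cSup_iff[of S "\<tau> - e"] S0 bS by (auto simp: \<tau>_def)
    have "t \<le> \<tau>" unfolding \<tau>_def using t(1) bS by (rule cSup_upper)
    then have "F \<tau> \<le> F t + (\<tau> - t)" by (rule Fdiff)
    then show "F \<tau> \<le> v + e" using t by (simp add: S_def)
  qed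
  have ge: "v \<le> F \<tau>"
  proof (rule field_le_epsilon)
    fix e :: real assume "0 < e"
    then show "v \<le> F \<tau> + e" using gt[of "\<tau> + e"] Fdiff[of \<tau> "\<tau> + e"] by simp
  qed
  have "\<tau> \<in> T"
  proof (rule ccontr)
    assume "\<tau> \<notin> T"
    then obtain d where d: "0 < d" "\<And>y. dist y \<tau> < d \<Longrightarrow> y \<notin> T"
      using compact_imp_closed[OF T(1)] by (auto simp: closed_def open_dist)
    have "y \<notin> T" if "\<tau> < y" "y \<le> \<tau> + d / 2" for y
      using d(2)[of y] that d(1) by (simp add: dist_real_def)
    then have "T \<inter> {..\<tau> + d / 2} = T \<inter> {..\<tau>}" using d(1) by (force simp: not_less)
    then have "F (\<tau> + d / 2) = F \<tau>" by (simp add: F_def)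
    then show False using gt[of "\<tau> + d / 2"] d(1) le by simp
  qed
  then show ?thesis using le ge that by (simp add: F_def)
qed

lemma remez_sublevel_measure_le:
  fixes P :: "real poly"
  assumes deg: "degree P \<le> n" and n: "0 < n" and P0: "1 / 2 < \<bar>poly P 0\<bar>" and e: "0 < e" and L: "0 \<le> L"
  shows "measure lborel {t \<in> {0..L}. \<bar>poly P t\<bar> \<le> e ^ n} \<le> 4 * e * L"
proof (rule ccontr)
  define T where "T = {t \<in> {0..L}. \<bar>poly P t\<bar> \<le> e ^ n}"
  assume "\<not> ?thesis"
  then have big: "4 * e * L < measure lborel T" by (simp add: T_def)
  have "closed T"
    unfolding T_def Collect_conj_eq Collect_mem_eq
    by (intro closed_Int closed_atLeastAtMost closed_Collect_le continuous_intros)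
  then have T: "compact T" "T \<subseteq> {0..L}"
    by (auto simp: T_def compact_eq_bounded_closed intro: bounded_subset[of "{0..L}"])
  \<comment> \<open>For \<open>L = 0\<close> the set \<open>T\<close> has at most one point, hence
    measure 0, against \<open>big\<close>.\<close>
  have "0 < L"
  proof (rule ccontr)
    assume "\<not> 0 < L"
    then have "T \<subseteq> {0}" using L by (auto simp: T_def)
    then have "T = {} \<or> T = {0}" by auto
    then show False using big L e by (auto simp: mult_less_0_iff)
  qed
  obtain k where k: "n = Suc k" using n by (cases n) auto
  let ?x = "cheb_node n"
  \<comment> \<open>The Chebyshev nodes are mapped affinely from [-1,1] onto [0, 4eL] and used as
    levels of the distribution function; \<open>big\<close> places all these levels below the
    measure of \<open>T\<close>.\<close>
  have "\<exists>t. t \<in> T \<and> measure lborel (T \<inter> {..t}) = 2 * e * L * (1 + ?x j)" for j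
  proof -
    have "2 * e * L * (1 + ?x j) \<le> 2 * e * L * 2"
      using cheb_node_bounds[of n j] e L by (intro mult_left_mono) auto
    then have "2 * e * L * (1 + ?x j) < measure lborel T" using big by linarith
    moreover have "0 \<le> 2 * e * L * (1 + ?x j)" using cheb_node_bounds[of n j] e L by simp
    ultimately show ?thesis using compact_measure_level_point[OF T] by metis
  qed
  then obtain t where t: "\<And>j. t j \<in> T" "\<And>j. measure lborel (T \<inter> {..t j}) = 2 * e * L * (1 + ?x j)"
    by metis
  have le: "2 * e * L * \<bar>?x j - ?x i\<bar> \<le> \<bar>t j - t i\<bar>" for i j
  proof -
    have *: "2 * e * L * (1 + ?x j) - 2 * e * L * (1 + ?x i) \<le> t j - t i" if "t i \<le> t j" for i j
      using measure_Int_atMost_diff_le[OF _ T(2) that] T(1) by (simp add: t borel_compact)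
    have **: "0 \<le> 2 * e * L * (1 + ?x j) - 2 * e * L * (1 + ?x i)" if "t i \<le> t j" for i j
      unfolding t(2)[symmetric] using that T(1) emeasure_compact_finite[OF T(1)]
      by (simp, intro measure_mono_fmeasurable fmeasurable_Int_fmeasurable)
         (auto simp: fmeasurable_def borel_compact)
    \<comment> \<open>The levels are ordered like the points, and their differences are bounded by
      those of the points; hence the claim for either order of \<open>t i\<close> and
      \<open>t j\<close>.\<close>
    have "2 * e * L * \<bar>?x j - ?x i\<bar> = \<bar>2 * e * L * (1 + ?x j) - 2 * e * L * (1 + ?x i)\<bar>"
      using e L by (simp add: abs_mult flip: right_diff_distrib)
    also have "\<dots> \<le> \<bar>t j - t i\<bar>"
      using *[of i j] *[of j i] **[of i j] **[of j i] by linarith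
    finally show ?thesis .
  qed
  have tb: "\<bar>t j\<bar> \<le> L" "\<bar>poly P (t j)\<bar> \<le> e ^ n" for j
    using t(1)[of j] by (auto simp: T_def)
  have "\<bar>poly P 0\<bar> \<le> e ^ n * (L / (2 * e * L)) ^ n * 2 ^ k"
    unfolding k
    by (rule abs_poly_0_le_cheb_spread) (use deg e \<open>0 < L\<close> le tb in \<open>auto simp: k\<close>)
  also have "\<dots> = (e * (L / (2 * e * L))) ^ n * 2 ^ k" by (simp only: power_mult_distrib)
  also have "e * (L / (2 * e * L)) = 1 / 2" using e \<open>0 < L\<close> by simp
  also have "(1 / 2 :: real) ^ n * 2 ^ k = 1 / 2" by (simp add: k power_one_over)
  finally show False using P0 by simp
qed

section \<open>Homotheties and the volume of subsets of star-shaped bodies\<close>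

text \<open>The homothety with centre \<open>c\<close> and ratio \<open>t\<close>. The restriction
  to \<open>I\<close> keeps the values extensional, hence inside the space of the product
  measure.\<close>

definition dilate :: "nat set \<Rightarrow> (nat \<Rightarrow> real) \<Rightarrow> real \<Rightarrow> (nat \<Rightarrow> real) \<Rightarrow> nat \<Rightarrow> real" where
  "dilate I c t x = (\<lambda>i\<in>I. c i + t * (x i - c i))"

lemma measurable_dilate [measurable (raw)]:
  assumes "f \<in> borel_measurable M" "g \<in> M \<rightarrow>\<^sub>M (\<Pi>\<^sub>M i\<in>I. lborel)"
  shows "(\<lambda>z. dilate I c (f z) (g z)) \<in> M \<rightarrow>\<^sub>M (\<Pi>\<^sub>M i\<in>I. lborel)"
  unfolding dilate_def
proof (rule measurable_restrict)
  fix i assume i: "i \<in> I"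
  have "(\<lambda>z. g z i) \<in> borel_measurable M"
    using measurable_compose[OF assms(2) measurable_component_singleton[OF i]] by simp
  then show "(\<lambda>z. c i + f z * (g z i - c i)) \<in> M \<rightarrow>\<^sub>M lborel"
    using assms(1) by simp
qed

lemma dilate_dilate: "dilate I c s (dilate I c t x) = dilate I c (s * t) x"
  by (auto simp: dilate_def fun_eq_iff restrict_def mult.assoc)

lemma dilate_1: "x \<in> extensional I \<Longrightarrow> dilate I c 1 x = x"
  by (auto simp: dilate_def fun_eq_iff restrict_def extensional_def)

interpretation lborel_family: product_sigma_finite "\<lambda>_::nat. lborel :: real measure"
  by standard

text \<open>Change of variables with Jacobian \<open>t ^ card I\<close>. It suffices to compare the
  measures on boxes, where it splits into one-dimensional affine substitutions.\<close>

lemma nn_integral_dilate: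
  assumes I: "finite I" and t: "0 < t" and f [measurable]: "f \<in> borel_measurable (\<Pi>\<^sub>M i\<in>I. lborel)"
  shows "(\<integral>\<^sup>+x. f x \<partial>(\<Pi>\<^sub>M i\<in>I. lborel)) = ennreal (t ^ card I) * (\<integral>\<^sup>+x. f (dilate I c t x) \<partial>(\<Pi>\<^sub>M i\<in>I. lborel))"
proof -
  let ?M = "\<Pi>\<^sub>M i\<in>I. (lborel :: real measure)"
  let ?P = "scale_measure (ennreal (t ^ card I)) (distr ?M ?M (dilate I c t))"
  have "?M = ?P"
  proof (rule lborel_family.PiM_eqI[OF I, symmetric])
    show "sets ?P = sets ?M" by simp
    fix A :: "nat \<Rightarrow> real set" assume A: "\<And>i. i \<in> I \<Longrightarrow> A i \<in> sets lborel"
    have box: "Pi\<^sub>E I A \<in> sets ?M" using I A by (intro sets_PiM_I_finite) auto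
    have pre: "(\<lambda>x. c i + t * (x - c i)) -` A i \<in> sets lborel" if "i \<in> I" for i
    proof -
      have "(\<lambda>x. c i + t * (x - c i)) -` A i \<inter> space borel \<in> sets borel"
        by (rule measurable_sets[of _ _ borel]) (use A[OF that] in auto)
      then show ?thesis by simp
    qed
    have "emeasure ?P (Pi\<^sub>E I A) = ennreal (t ^ card I) * emeasure ?M (dilate I c t -` Pi\<^sub>E I A \<inter> space ?M)"
      using box by (simp add: emeasure_distr)
    also have "dilate I c t -` Pi\<^sub>E I A \<inter> space ?M = Pi\<^sub>E I (\<lambda>i. (\<lambda>x. c i + t * (x - c i)) -` A i)"
      by (auto simp: dilate_def space_PiM PiE_iff)
    also have "emeasure ?M \<dots> = (\<Prod>i\<in>I. emeasure lborel ((\<lambda>x. c i + t * (x - c i)) -` A i))"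
      using pre by (intro lborel_family.emeasure_PiM I) auto
    also have "ennreal (t ^ card I) * \<dots> = (\<Prod>i\<in>I. ennreal t * emeasure lborel ((\<lambda>x. c i + t * (x - c i)) -` A i))"
      using t by (simp add: prod.distrib ennreal_power)
    also have "\<dots> = (\<Prod>i\<in>I. emeasure lborel (A i))"
    proof (rule prod.cong[OF refl])
      fix i assume i: "i \<in> I"
      have "emeasure lborel (A i) = (\<integral>\<^sup>+x. indicator (A i) x \<partial>lborel)" using A[OF i] by simp
      also have "\<dots> = ennreal t * (\<integral>\<^sup>+x. indicator (A i) ((c i - t * c i) + t * x) \<partial>lborel)"
        using t A[OF i] nn_integral_real_affine[of "indicator (A i)" t "c i - t * c i"] by simp
      also have "(\<lambda>x. indicator (A i) ((c i - t * c i) + t * x) :: ennreal)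
          = indicator ((\<lambda>x. c i + t * (x - c i)) -` A i)"
        by (auto simp: fun_eq_iff indicator_def algebra_simps)
      finally show "ennreal t * emeasure lborel ((\<lambda>x. c i + t * (x - c i)) -` A i) = emeasure lborel (A i)"
        using pre[OF i] by simp
    qed
    finally show "emeasure ?P (Pi\<^sub>E I A) = (\<Prod>i\<in>I. emeasure lborel (A i))" .
  qed
  then have "(\<integral>\<^sup>+x. f x \<partial>?M) = (\<integral>\<^sup>+x. f x \<partial>?P)" by simp
  also have "\<dots> = ennreal (t ^ card I) * (\<integral>\<^sup>+x. f (dilate I c t x) \<partial>?M)"
    by (simp add: nn_integral_scale_measure nn_integral_distr)
  finally show ?thesis .
qed

lemma nn_integral_inverse_power_tail:
  fixes L :: real
  assumes "0 < L"
  shows "(\<integral>\<^sup>+t. ennreal (real (Suc k) / t ^ Suc (Suc k)) * indicator {1 / L..} t \<partial>lborel) = ennreal (L ^ Suc k)"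
proof -
  have *: "((\<lambda>t. - (1 / t ^ Suc k)) has_real_derivative real (Suc k) / t ^ Suc (Suc k)) (at t)"
    if "1 / L \<le> t" for t :: real
  proof -
    have "0 < 1 / L" using assms by simp
    then have "0 < t" using that by (rule less_le_trans)
    have "((\<lambda>t. t ^ Suc k) has_real_derivative real (Suc k) * t ^ k) (at t)"
      using DERIV_pow[of "Suc k" t] by simp
    from DERIV_minus[OF DERIV_inverse'[OF this]] \<open>0 < t\<close>
    have "((\<lambda>t. - inverse (t ^ Suc k)) has_real_derivative
        inverse (t ^ Suc k) * (real (Suc k) * t ^ k) * inverse (t ^ Suc k)) (at t)" by simp
    also have "inverse (t ^ Suc k) * (real (Suc k) * t ^ k) * inverse (t ^ Suc k)
        = real (Suc k) / t ^ Suc (Suc k)"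
      using \<open>0 < t\<close> by (simp add: field_simps)
    finally show ?thesis by (simp only: inverse_eq_divide)
  qed
  have "(\<integral>\<^sup>+t. ennreal (real (Suc k) / t ^ Suc (Suc k)) * indicator {1 / L..} t \<partial>lborel)
      = ennreal (0 - (- (1 / (1 / L) ^ Suc k)))"
  proof (rule nn_integral_FTC_atLeast[OF _ *])
    fix x assume "1 / L \<le> x"
    then have "0 \<le> x" using assms by (smt (verit) divide_pos_pos)
    then show "0 \<le> real (Suc k) / x ^ Suc (Suc k)" by simp
  next
    have "((\<lambda>t::real. - (1 / t ^ Suc k)) \<longlongrightarrow> - 0) at_top"
      by (intro tendsto_minus tendsto_divide_0[OF tendsto_const] filterlim_at_top_imp_at_infinity
            filterlim_pow_at_top filterlim_ident) simp
    then show "((\<lambda>t::real. - (1 / t ^ Suc k)) \<longlongrightarrow> 0) at_top" by simp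
  qed auto
  then show ?thesis by (simp add: power_one_over)
qed

text \<open>
  The weight \<open>\<integral>\<^sub>0\<^sup>\<infinity> m t\<^bsup>-m-1\<^esup> 1\<^sub>K(c + (y - c)/t) dt\<close> equals the \<open>m\<close>-th power of the length
  of the ray from \<open>c\<close> through \<open>y\<close> inside \<open>K\<close>, in units of \<open>y - c\<close>. Inserting it into the volume
  integral and exchanging the order of integration replaces polar coordinates around \<open>c\<close>.
\<close>

lemma star_body_emeasure_le:
  fixes c :: "nat \<Rightarrow> real"
  assumes I: "finite I" "card I = Suc k"
    and K [measurable]: "K \<in> sets (\<Pi>\<^sub>M i\<in>I. lborel)" and A [measurable]: "A \<in> sets (\<Pi>\<^sub>M i\<in>I. lborel)"
    and AK: "A \<subseteq> K" and cA: "c \<notin> A" and c: "c \<in> extensional I" and d: "0 \<le> d"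
    and ray: "\<And>y. y \<in> K \<Longrightarrow> y \<noteq> c \<Longrightarrow> \<exists>L\<ge>1. (\<forall>t>0. dilate I c t y \<in> K \<longleftrightarrow> t \<le> L) \<and>
       emeasure lborel {t \<in> {0..L}. dilate I c t y \<in> A} \<le> ennreal (d * L)"
  shows "emeasure (\<Pi>\<^sub>M i\<in>I. lborel) A \<le> ennreal (real (Suc k) * d) * emeasure (\<Pi>\<^sub>M i\<in>I. lborel) K"
proof -
  let ?M = "\<Pi>\<^sub>M i\<in>I. (lborel :: real measure)"
  interpret M: sigma_finite_measure ?M by (rule lborel_family.sigma_finite[OF I(1)])
  interpret P: pair_sigma_finite ?M "lborel :: real measure" ..
  define \<phi> where "\<phi> t = ennreal (real (Suc k) / t ^ Suc (Suc k)) * indicator {0<..} t" for t :: real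
  have [measurable]: "\<phi> \<in> borel_measurable borel" unfolding \<phi>_def by measurable
  define w where "w y = (\<integral>\<^sup>+t. \<phi> t * indicator K (dilate I c (1 / t) y) \<partial>lborel)" for y
  have [measurable]: "w \<in> borel_measurable ?M" unfolding w_def by measurable
  \<comment> \<open>Homogeneity of degree -m in y - c, with m = \<open>Suc k\<close>, by the
    substitution t = s u. After a dilation the weight is thus again a multiple of
    \<open>w y\<close>, with a factor depending on \<open>s\<close> only.\<close>
  have hom: "w (dilate I c s y) = ennreal (1 / s ^ Suc k) * w y" if s: "0 < s" and y: "y \<in> space ?M" for s y
  proof -
    have "w (dilate I c s y) = (\<integral>\<^sup>+t. \<phi> t * indicator K (dilate I c (s / t) y) \<partial>lborel)"
      by (simp add: w_def dilate_dilate)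
    also have "\<dots> = ennreal s * (\<integral>\<^sup>+u. \<phi> (s * u) * indicator K (dilate I c (s / (s * u)) y) \<partial>lborel)"
      using s y nn_integral_real_affine[of "\<lambda>t. \<phi> t * indicator K (dilate I c (s / t) y)" s 0] by simp
    also have "(\<lambda>u. \<phi> (s * u) * indicator K (dilate I c (s / (s * u)) y))
        = (\<lambda>u. ennreal (1 / s ^ Suc (Suc k)) * (\<phi> u * indicator K (dilate I c (1 / u) y)))"
    proof
      fix u
      have "\<phi> (s * u) = ennreal (1 / s ^ Suc (Suc k)) * \<phi> u"
        using s by (cases "0 < u")
          (simp_all add: \<phi>_def zero_less_mult_iff power_mult_distrib flip: ennreal_mult)
      then show "\<phi> (s * u) * indicator K (dilate I c (s / (s * u)) y)
        = ennreal (1 / s ^ Suc (Suc k)) * (\<phi> u * indicator K (dilate I c (1 / u) y))"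
        using s by (simp add: mult.assoc)
    qed
    also have "(\<integral>\<^sup>+u. ennreal (1 / s ^ Suc (Suc k)) * (\<phi> u * indicator K (dilate I c (1 / u) y)) \<partial>lborel)
        = ennreal (1 / s ^ Suc (Suc k)) * w y"
      unfolding w_def using y by (intro nn_integral_cmult) measurable
    also have "ennreal s * (ennreal (1 / s ^ Suc (Suc k)) * w y) = ennreal (1 / s ^ Suc k) * w y"
      using s by (simp add: mult.assoc[symmetric] flip: ennreal_mult)
    finally show ?thesis .
  qed
  have extM: "dilate I c (1 / t) (dilate I c t y) = y" if "0 < t" "y \<in> space ?M" for t y
    using that by (simp add: dilate_dilate dilate_1 space_PiM PiE_def)
  \<comment> \<open>The dilate by 1/t lies in \<open>K\<close> exactly for t >= 1/L, so the weight
    is a tail integral. Its value is positive and finite, which permits cancelling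
    \<open>w y\<close> against its inverse.\<close>
  have wval: "w y = ennreal (L ^ Suc k)"
    if L: "1 \<le> L" "\<And>t. 0 < t \<Longrightarrow> dilate I c t y \<in> K \<longleftrightarrow> t \<le> L" for y L
  proof -
    have "w y = (\<integral>\<^sup>+t. ennreal (real (Suc k) / t ^ Suc (Suc k)) * indicator {1 / L..} t \<partial>lborel)"
      unfolding w_def
    proof (rule nn_integral_cong)
      fix t :: real
      have "0 < t \<and> dilate I c (1 / t) y \<in> K \<longleftrightarrow> 1 / L \<le> t"
      proof (cases "0 < t")
        case True
        then show ?thesis using L(1) L(2)[of "1 / t"] by (simp add: field_simps)
      next
        case False
        then show ?thesis using L(1) by (smt (verit) divide_pos_pos)
      qed
      then show "\<phi> t * indicator K (dilate I c (1 / t) y)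
          = ennreal (real (Suc k) / t ^ Suc (Suc k)) * indicator {1 / L..} t"
        by (auto simp: \<phi>_def indicator_def)
    qed
    then show ?thesis using nn_integral_inverse_power_tail[of L k] L(1) by simp
  qed
  \<comment> \<open>The estimate along one ray: \<open>t ^ k\<close> is at most \<open>L ^ k\<close>
    there, and the part of the ray in \<open>A\<close> has length at most dL, so the integral is at
    most m d L^m = m d \<open>w y\<close>.\<close>
  have inner: "indicator K y * inverse (w y) * (\<integral>\<^sup>+t. ennreal (real (Suc k) * t ^ k) * indicator {0<..} t * indicator A (dilate I c t y) \<partial>lborel)
      \<le> ennreal (real (Suc k) * d) * indicator K y" (is "_ * _ * ?J \<le> _") if y: "y \<in> space ?M" for y
  proof (cases "y \<in> K \<and> y \<noteq> c")
    case False
    have "dilate I c t c = c" for t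
      using c by (auto simp: dilate_def fun_eq_iff restrict_def extensional_def)
    with False cA show ?thesis by (auto simp: indicator_def)
  next
    case True
    then obtain L where L: "1 \<le> L" "\<And>t. 0 < t \<Longrightarrow> dilate I c t y \<in> K \<longleftrightarrow> t \<le> L"
      "emeasure lborel {t \<in> {0..L}. dilate I c t y \<in> A} \<le> ennreal (d * L)"
      using ray[of y] by blast
    let ?T = "{t \<in> {0..L}. dilate I c t y \<in> A}"
    have Tm: "?T \<in> sets borel"
    proof -
      have "(\<lambda>t. dilate I c t y) \<in> borel \<rightarrow>\<^sub>M ?M" using y by (intro measurable_dilate) auto
      then have "{t \<in> space borel. dilate I c t y \<in> A} \<in> sets borel" by measurable
      then have "{0..L} \<inter> {t \<in> space borel. dilate I c t y \<in> A} \<in> sets borel"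
        by (intro sets.Int) auto
      also have "{0..L} \<inter> {t \<in> space borel. dilate I c t y \<in> A} = ?T" by auto
      finally show ?thesis .
    qed
    have "?J \<le> (\<integral>\<^sup>+t. ennreal (real (Suc k) * L ^ k) * indicator ?T t \<partial>lborel)"
    proof (rule nn_integral_mono)
      fix t :: real
      show "ennreal (real (Suc k) * t ^ k) * indicator {0<..} t * indicator A (dilate I c t y)
        \<le> ennreal (real (Suc k) * L ^ k) * indicator ?T t"
      proof (cases "0 < t \<and> dilate I c t y \<in> A")
        case True
        then have "t \<le> L" using L(2)[of t] AK by auto
        with True show ?thesis
          by (auto simp: indicator_def intro!: ennreal_leI mult_left_mono power_mono)
      qed (auto simp: indicator_def)
    qed
    also have "\<dots> = ennreal (real (Suc k) * L ^ k) * emeasure lborel ?T"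
      by (rule nn_integral_cmult_indicator) (simp only: sets_lborel Tm)
    also have "\<dots> \<le> ennreal (real (Suc k) * L ^ k) * ennreal (d * L)"
      by (intro mult_left_mono L(3)) simp
    also have "\<dots> = ennreal (real (Suc k) * d) * w y"
      using wval[OF L(1,2)] L(1) d by (simp add: mult_ac flip: ennreal_mult)
    finally have "inverse (w y) * ?J \<le> inverse (w y) * (ennreal (real (Suc k) * d) * w y)"
      by (rule mult_left_mono) simp
    also have "\<dots> = ennreal (real (Suc k) * d) * (w y * inverse (w y))" by (simp only: mult_ac)
    also have "w y * inverse (w y) = 1"
      using wval[OF L(1,2)] L(1) by (simp add: ennreal_divide_self flip: divide_ennreal_def)
    finally show ?thesis using True by simp
  qed
  have "emeasure ?M A = (\<integral>\<^sup>+x. indicator A x \<partial>?M)" by simp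
  \<comment> \<open>On \<open>A\<close> the factor 1 is written as
    \<open>inverse (w x) * w x\<close>, with the second \<open>w x\<close> expanded into its
    defining integral.\<close>
  also have "\<dots> = (\<integral>\<^sup>+x. (\<integral>\<^sup>+t. indicator A x * inverse (w x) * (\<phi> t * indicator K (dilate I c (1 / t) x)) \<partial>lborel) \<partial>?M)"
  proof (rule nn_integral_cong)
    fix x assume x: "x \<in> space ?M"
    have "(\<integral>\<^sup>+t. indicator A x * inverse (w x) * (\<phi> t * indicator K (dilate I c (1 / t) x)) \<partial>lborel)
        = indicator A x * inverse (w x) * w x"
      unfolding w_def[of x] using x by (intro nn_integral_cmult) measurable
    also have "\<dots> = indicator A x"
    proof (cases "x \<in> A")
      case True
      then obtain L where L: "1 \<le> L" "\<And>t. 0 < t \<Longrightarrow> dilate I c t x \<in> K \<longleftrightarrow> t \<le> L"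
        using ray[of x] AK cA by blast
      have "w x * inverse (w x) = 1"
        using wval[OF L] L(1) by (simp add: ennreal_divide_self flip: divide_ennreal_def)
      then show ?thesis using True by (simp add: mult.commute)
    qed simp
    finally show "indicator A x = (\<integral>\<^sup>+t. indicator A x * inverse (w x) * (\<phi> t * indicator K (dilate I c (1 / t) x)) \<partial>lborel)" ..
  qed
  also have "\<dots> = (\<integral>\<^sup>+t. (\<integral>\<^sup>+x. indicator A x * inverse (w x) * (\<phi> t * indicator K (dilate I c (1 / t) x)) \<partial>?M) \<partial>lborel)"
    by (rule P.Fubini'[symmetric]) measurable
  also have "\<dots> = (\<integral>\<^sup>+t. (\<integral>\<^sup>+y. indicator K y * inverse (w y) * (ennreal (real (Suc k) * t ^ k) * indicator {0<..} t * indicator A (dilate I c t y)) \<partial>?M) \<partial>lborel)"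
  proof (rule nn_integral_cong)
    fix t :: real
    show "(\<integral>\<^sup>+x. indicator A x * inverse (w x) * (\<phi> t * indicator K (dilate I c (1 / t) x)) \<partial>?M)
      = (\<integral>\<^sup>+y. indicator K y * inverse (w y) * (ennreal (real (Suc k) * t ^ k) * indicator {0<..} t * indicator A (dilate I c t y)) \<partial>?M)"
    proof (cases "0 < t")
      case False
      then show ?thesis by (simp add: \<phi>_def)
    next
      case t: True
      \<comment> \<open>Substitution of the dilate of y by t for x. The Jacobian and the homogeneity
        of \<open>inverse (w x)\<close> each give t^m; with \<phi>(t) = m t^(-m-1) this leaves the
        radial density m t^(m-1).\<close>
      have "(\<integral>\<^sup>+x. indicator A x * inverse (w x) * (\<phi> t * indicator K (dilate I c (1 / t) x)) \<partial>?M)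
        = ennreal (t ^ Suc k) * (\<integral>\<^sup>+y. indicator A (dilate I c t y) * inverse (w (dilate I c t y)) *
            (\<phi> t * indicator K (dilate I c (1 / t) (dilate I c t y))) \<partial>?M)"
        by (subst nn_integral_dilate[OF I(1) t, where c = c]) (measurable, simp add: I(2))
      also have "\<dots> = (\<integral>\<^sup>+y. ennreal (t ^ Suc k) * (indicator A (dilate I c t y) * inverse (w (dilate I c t y)) *
            (\<phi> t * indicator K (dilate I c (1 / t) (dilate I c t y)))) \<partial>?M)"
        by (rule nn_integral_cmult[symmetric]) measurable
      also have "\<dots> = (\<integral>\<^sup>+y. indicator K y * inverse (w y) * (ennreal (real (Suc k) * t ^ k) * indicator {0<..} t * indicator A (dilate I c t y)) \<partial>?M)"
      proof (rule nn_integral_cong)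
        fix y assume y: "y \<in> space ?M"
        have inv: "inverse (w (dilate I c t y)) = ennreal (t ^ Suc k) * inverse (w y)"
          unfolding hom[OF t y] using t
          by (subst ennreal_inverse_mult') (simp_all add: inverse_ennreal)
        have ph: "ennreal (t ^ Suc k) * ennreal (t ^ Suc k) * \<phi> t = ennreal (real (Suc k) * t ^ k)"
        proof -
          have "t ^ Suc k * t ^ Suc k * (real (Suc k) / t ^ Suc (Suc k)) = real (Suc k) * t ^ k"
            using t by (simp add: field_simps)
          moreover have "\<phi> t = ennreal (real (Suc k) / t ^ Suc (Suc k))"
            using t by (simp add: \<phi>_def)
          ultimately show ?thesis
            using t by (simp del: power_Suc of_nat_Suc flip: ennreal_mult)
        qed
        show "ennreal (t ^ Suc k) * (indicator A (dilate I c t y) * inverse (w (dilate I c t y)) *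
            (\<phi> t * indicator K (dilate I c (1 / t) (dilate I c t y))))
          = indicator K y * inverse (w y) * (ennreal (real (Suc k) * t ^ k) * indicator {0<..} t * indicator A (dilate I c t y))"
          unfolding inv extM[OF t y] ph[symmetric] using t by (simp add: mult_ac)
      qed
      finally show ?thesis .
    qed
  qed
  also have "\<dots> = (\<integral>\<^sup>+y. (\<integral>\<^sup>+t. indicator K y * inverse (w y) * (ennreal (real (Suc k) * t ^ k) * indicator {0<..} t * indicator A (dilate I c t y)) \<partial>lborel) \<partial>?M)"
    by (rule P.Fubini') measurable
  also have "\<dots> \<le> (\<integral>\<^sup>+y. ennreal (real (Suc k) * d) * indicator K y \<partial>?M)"
  proof (rule nn_integral_mono)
    fix y assume y: "y \<in> space ?M"
    have "(\<integral>\<^sup>+t. indicator K y * inverse (w y) * (ennreal (real (Suc k) * t ^ k) * indicator {0<..} t * indicator A (dilate I c t y)) \<partial>lborel)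
      = indicator K y * inverse (w y) * (\<integral>\<^sup>+t. ennreal (real (Suc k) * t ^ k) * indicator {0<..} t * indicator A (dilate I c t y) \<partial>lborel)"
      using y by (intro nn_integral_cmult) measurable
    then show "(\<integral>\<^sup>+t. indicator K y * inverse (w y) * (ennreal (real (Suc k) * t ^ k) * indicator {0<..} t * indicator A (dilate I c t y)) \<partial>lborel)
      \<le> ennreal (real (Suc k) * d) * indicator K y" using inner[OF y] by simp
  qed
  also have "\<dots> = ennreal (real (Suc k) * d) * emeasure ?M K"
    by (rule nn_integral_cmult_indicator) measurable
  finally show ?thesis .
qed

section \<open>Polynomials on lines and their sublevel sets in the cube\<close>

definition line_poly :: "mpoly \<Rightarrow> (nat \<Rightarrow> real) \<Rightarrow> (nat \<Rightarrow> real) \<Rightarrow> real poly" where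
  "line_poly P a b = (\<Sum>k\<in>Poly_Mapping.keys P. smult (Poly_Mapping.lookup P k)
     (\<Prod>i\<in>Poly_Mapping.keys k. [:a i, b i:] ^ Poly_Mapping.lookup k i))"

lemma poly_line_poly: "poly (line_poly P a b) t = mpoly_eval P (\<lambda>i. a i + t * b i)"
  by (simp add: line_poly_def mpoly_eval_def poly_sum poly_prod)

lemma degree_line_poly: "degree (line_poly P a b) \<le> mpoly_degree P"
  unfolding line_poly_def
proof (intro degree_sum_le finite_keys)
  fix k assume k: "k \<in> Poly_Mapping.keys P"
  let ?f = "\<lambda>i. [:a i, b i:] ^ Poly_Mapping.lookup k i"
  have "degree (\<Prod>i\<in>Poly_Mapping.keys k. ?f i) \<le> (\<Sum>i\<in>Poly_Mapping.keys k. degree (?f i))"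
    using degree_prod_sum_le[of "Poly_Mapping.keys k" ?f] by (simp add: o_def)
  also have "\<dots> \<le> (\<Sum>i\<in>Poly_Mapping.keys k. Poly_Mapping.lookup k i)"
  proof (rule sum_mono)
    fix i
    have "degree (?f i) \<le> degree [:a i, b i:] * Poly_Mapping.lookup k i" by (rule degree_power_le)
    also have "\<dots> \<le> 1 * Poly_Mapping.lookup k i" by (intro mult_right_mono) auto
    finally show "degree (?f i) \<le> Poly_Mapping.lookup k i" by simp
  qed
  also have "\<dots> = monom_degree k" by (simp add: monom_degree_def)
  also have "\<dots> \<le> mpoly_degree P"
    unfolding mpoly_degree_def using k by (intro Max_ge) auto
  finally show "degree (smult (Poly_Mapping.lookup P k) (\<Prod>i\<in>Poly_Mapping.keys k. ?f i)) \<le> mpoly_degree P"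
    using degree_smult_le order.trans by blast
qed

text \<open>Exponents at the keys of a monomial are nonzero, so a monomial of degree 0 contains no
  variable.\<close>

lemma mpoly_eval_degree_0:
  assumes "mpoly_degree P = 0"
  shows "mpoly_eval P x = mpoly_eval P y"
proof -
  have "Poly_Mapping.keys k = {}" if "k \<in> Poly_Mapping.keys P" for k
  proof -
    have "monom_degree k \<le> mpoly_degree P"
      unfolding mpoly_degree_def using that by (intro Max_ge) auto
    then have "\<forall>i\<in>Poly_Mapping.keys k. Poly_Mapping.lookup k i = 0"
      using assms by (simp add: monom_degree_def)
    then show ?thesis by (metis in_keys_iff equals0I)
  qed
  then show ?thesis by (intro mpoly_eval_cong) (unfold mpoly_vars_def, blast)
qed

lemma mpoly_degree_eq_0_if_no_vars:
  assumes "mpoly_vars P = {}"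
  shows "mpoly_degree P = 0"
proof -
  have "monom_degree k = 0" if "k \<in> Poly_Mapping.keys P" for k
    using assms that by (auto simp: mpoly_vars_def monom_degree_def)
  then have *: "insert 0 (monom_degree ` Poly_Mapping.keys P) = {0}" by auto
  show ?thesis unfolding mpoly_degree_def * by simp
qed

lemma measurable_mpoly_eval:
  assumes "\<And>i. i \<in> mpoly_vars P \<Longrightarrow> (\<lambda>x. g x i) \<in> borel_measurable M"
  shows "(\<lambda>x. mpoly_eval P (g x)) \<in> borel_measurable M"
  unfolding mpoly_eval_def
  by (intro borel_measurable_sum borel_measurable_times borel_measurable_const
      borel_measurable_prod borel_measurable_power assms) (auto simp: mpoly_vars_def)

lemma sets_cube: "cube m \<in> sets (\<Pi>\<^sub>M i\<in>{..<m}. lborel)"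
  unfolding cube_def by (intro sets_PiM_I_finite) (auto simp: sym_interval_def)

text \<open>Only coordinates in which \<open>y\<close> and \<open>c\<close> differ constrain
  \<open>t\<close>. For such an \<open>i\<close>, \<open>r i\<close> is the ratio at which the ray
  leaves [-1,1] in that coordinate, so \<open>L\<close> is the minimum of these; it is at least 1
  because ratio 1 gives \<open>y\<close> itself.\<close>

lemma cube_ray_length:
  assumes c: "c \<in> cube m" and y: "y \<in> cube m" "y \<noteq> c"
  obtains L where "1 \<le> L" "\<And>t. 0 < t \<Longrightarrow> dilate {..<m} c t y \<in> cube m \<longleftrightarrow> t \<le> L"
proof -
  define J where "J = {i. i < m \<and> y i \<noteq> c i}"
  have cb: "-1 \<le> c i" "c i \<le> 1" and yb: "-1 \<le> y i" "y i \<le> 1" if "i < m" for i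
    using c y that by (auto simp: cube_def sym_interval_def PiE_iff)
  have "\<exists>i<m. y i \<noteq> c i"
    using c y by (auto simp: cube_def PiE_iff extensional_def fun_eq_iff) (metis lessThan_iff)
  then have J: "finite J" "J \<noteq> {}" by (auto simp: J_def)
  define r where "r i = (if c i < y i then (1 - c i) / (y i - c i) else (1 + c i) / (c i - y i))" for i
  have r: "- 1 \<le> c i + t * (y i - c i) \<and> c i + t * (y i - c i) \<le> 1 \<longleftrightarrow> t \<le> r i"
    if i: "i \<in> J" and t: "0 < t" for i t
  proof (cases "c i < y i")
    case True
    then have "0 \<le> t * (y i - c i)" using t by simp
    then show ?thesis using True cb[of i] i by (auto simp: r_def J_def le_divide_eq)
  next
    case False
    then have *: "y i < c i" using i by (simp add: J_def)
    then have "t * (y i - c i) \<le> 0" using t by (simp add: mult_le_0_iff)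
    then show ?thesis using * cb[of i] i by (auto simp: r_def J_def le_divide_eq algebra_simps)
  qed
  have *: "dilate {..<m} c t y \<in> cube m \<longleftrightarrow> t \<le> Min (r ` J)" if t: "0 < t" for t
  proof -
    have "dilate {..<m} c t y \<in> cube m \<longleftrightarrow> (\<forall>i<m. - 1 \<le> c i + t * (y i - c i) \<and> c i + t * (y i - c i) \<le> 1)"
      by (auto simp: cube_def dilate_def PiE_iff sym_interval_def)
    also have "\<dots> \<longleftrightarrow> (\<forall>i\<in>J. - 1 \<le> c i + t * (y i - c i) \<and> c i + t * (y i - c i) \<le> 1)"
      using cb by (auto simp: J_def)
    also have "\<dots> \<longleftrightarrow> t \<le> Min (r ` J)" using r[OF _ t] J by simp
    finally show ?thesis .
  qed
  have "1 \<le> r i" if "i \<in> J" for i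
    using r[OF that, of 1] yb[of i] that by (auto simp: J_def)
  then have "1 \<le> Min (r ` J)" using J by simp
  then show ?thesis using * that by blast
qed

lemma cube_sublevel_emeasure_le:
  assumes vars: "mpoly_vars P \<subseteq> {..<m}" and deg: "mpoly_degree P \<le> n" and n: "0 < n"
    and c: "c \<in> cube m" "1 / 2 < \<bar>mpoly_eval P c\<bar>" and m: "0 < m" and e: "0 < e" "4 * e < 1"
  shows "emeasure (\<Pi>\<^sub>M i\<in>{..<m}. lborel) {x \<in> cube m. \<bar>mpoly_eval P x\<bar> \<le> e ^ n}
    \<le> ennreal (4 * real m * e) * emeasure (\<Pi>\<^sub>M i\<in>{..<m}. lborel) (cube m)"
proof -
  let ?M = "\<Pi>\<^sub>M i\<in>{..<m}. (lborel :: real measure)"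
  define A where "A = {x \<in> cube m. \<bar>mpoly_eval P x\<bar> \<le> e ^ n}"
  obtain k where k: "m = Suc k" using m by (cases m) auto
  have [measurable]: "mpoly_eval P \<in> borel_measurable ?M"
  proof (rule measurable_mpoly_eval)
    fix i assume "i \<in> mpoly_vars P"
    then have "(\<lambda>x. x i) \<in> ?M \<rightarrow>\<^sub>M lborel" using vars by (intro measurable_component_singleton) auto
    then show "(\<lambda>x. x i) \<in> borel_measurable ?M" by simp
  qed
  have "{x \<in> space ?M. \<bar>mpoly_eval P x\<bar> \<le> e ^ n} \<in> sets ?M" by measurable
  then have "cube m \<inter> {x \<in> space ?M. \<bar>mpoly_eval P x\<bar> \<le> e ^ n} \<in> sets ?M"
    using sets_cube by (rule sets.Int[rotated])
  also have "cube m \<inter> {x \<in> space ?M. \<bar>mpoly_eval P x\<bar> \<le> e ^ n} = A"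
    using sets.sets_into_space[OF sets_cube[of m]] by (auto simp: A_def)
  finally have A: "A \<in> sets ?M" .
  \<comment> \<open>As e < 1/4 and n > 0, the level e^n stays below 1/2, so the centre is outside
    \<open>A\<close>.\<close>
  have "e ^ n \<le> e ^ 1" using e n by (intro power_decreasing) auto
  then have cA: "c \<notin> A" using c e by (auto simp: A_def)
  have "emeasure ?M A \<le> ennreal (real (Suc k) * (4 * e)) * emeasure ?M (cube m)"
  proof (rule star_body_emeasure_le[where c = c])
    fix y assume y: "y \<in> cube m" "y \<noteq> c"
    obtain L where L: "1 \<le> L" "\<And>t. 0 < t \<Longrightarrow> dilate {..<m} c t y \<in> cube m \<longleftrightarrow> t \<le> L"
      using cube_ray_length[OF c(1) y] by blast
    let ?p = "line_poly P c (\<lambda>i. y i - c i)"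
    have ev: "mpoly_eval P (dilate {..<m} c t y) = poly ?p t" for t
      unfolding poly_line_poly using vars by (intro mpoly_eval_cong) (auto simp: dilate_def)
    have "closed {t \<in> {0..L}. \<bar>poly ?p t\<bar> \<le> e ^ n}"
      unfolding Collect_conj_eq Collect_mem_eq
      by (intro closed_Int closed_atLeastAtMost closed_Collect_le continuous_intros)
    then have meas: "{t \<in> {0..L}. \<bar>poly ?p t\<bar> \<le> e ^ n} \<in> sets lborel" by (simp add: borel_closed)
    have fin: "emeasure lborel {t \<in> {0..L}. \<bar>poly ?p t\<bar> \<le> e ^ n} \<noteq> \<infinity>"
    proof -
      have "emeasure lborel {t \<in> {0..L}. \<bar>poly ?p t\<bar> \<le> e ^ n} \<le> emeasure lborel {0..L}"
        by (rule emeasure_mono) auto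
      also have "\<dots> < \<infinity>" using L by simp
      finally show ?thesis by simp
    qed
    have "emeasure lborel {t \<in> {0..L}. dilate {..<m} c t y \<in> A}
        \<le> emeasure lborel {t \<in> {0..L}. \<bar>poly ?p t\<bar> \<le> e ^ n}"
      using meas by (intro emeasure_mono) (auto simp: A_def ev)
    also have "\<dots> = ennreal (measure lborel {t \<in> {0..L}. \<bar>poly ?p t\<bar> \<le> e ^ n})"
      using fin by (intro emeasure_eq_ennreal_measure) simp
    also have "\<dots> \<le> ennreal (4 * e * L)"
    proof (intro ennreal_leI remez_sublevel_measure_le n e(1))
      show "degree ?p \<le> n" using degree_line_poly deg by (rule order.trans)
      show "1 / 2 < \<bar>poly ?p 0\<bar>" using c by (simp add: poly_line_poly)
      show "0 \<le> L" using L by simp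
    qed
    finally show "\<exists>L\<ge>1. (\<forall>t>0. dilate {..<m} c t y \<in> cube m \<longleftrightarrow> t \<le> L) \<and>
       emeasure lborel {t \<in> {0..L}. dilate {..<m} c t y \<in> A} \<le> ennreal (4 * e * L)"
      using L by blast
  next
    show "c \<in> extensional {..<m}" using c(1) by (simp add: cube_def PiE_def)
  next
    show "card {..<m} = Suc k" by (simp add: k)
    show "A \<subseteq> cube m" by (auto simp: A_def)
    show "0 \<le> 4 * e" using e by simp
  qed (rule finite_lessThan sets_cube A cA)+
  then show ?thesis by (simp add: A_def k mult_ac)
qed

section \<open>Transfer from the cube to the space of sequences\<close>

lemma emeasure_interval_measure:
  assumes "X \<in> sets borel"
  shows "emeasure interval_measure (X \<inter> sym_interval) = emeasure (uniform_measure lborel sym_interval) X"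
proof -
  have [measurable]: "sym_interval \<in> sets borel" by (simp add: sym_interval_def)
  have s: "X \<inter> sym_interval \<in> sets (restrict_space lborel sym_interval)"
    "sym_interval \<in> sets (restrict_space lborel sym_interval)"
    using assms by (auto simp: sets_restrict_space)
  show ?thesis
    unfolding interval_measure_def using s assms
    by (simp add: emeasure_restrict_space Int_ac sym_interval_def)
qed

lemma measurable_seq_coordinate: "(\<lambda>f. f i) \<in> borel_measurable seq_measure"
proof -
  have s: "sets interval_measure = sets (restrict_space lborel sym_interval)"
    by (simp add: interval_measure_def)
  have "(\<lambda>x. x) \<in> interval_measure \<rightarrow>\<^sub>M borel"
    unfolding measurable_cong_sets[OF s refl]
    by (intro measurable_restrict_space1) simp
  then show ?thesis
    unfolding seq_measure_def
    using measurable_compose[OF measurable_component_singleton[of i UNIV "\<lambda>_. interval_measure"]] by simp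
qed

text \<open>This carries volume estimates over to sequences: both sides agree on boxes with the
  product of the one-dimensional uniform measures.\<close>

lemma distr_seq_measure_restrict:
  "distr seq_measure (\<Pi>\<^sub>M i\<in>{..<m}. lborel) (\<lambda>f. restrict f {..<m})
    = uniform_measure (\<Pi>\<^sub>M i\<in>{..<m}. lborel) (cube m)"
proof -
  let ?M = "\<Pi>\<^sub>M i\<in>{..<m}. (lborel :: real measure)"
  let ?u = "uniform_measure lborel sym_interval :: real measure"
  have sym [measurable]: "sym_interval \<in> sets borel" by (simp add: sym_interval_def)
  interpret iv: product_prob_space "\<lambda>_. interval_measure" "UNIV :: nat set"
    by (intro product_prob_spaceI prob_space_interval_measure)
  interpret u: product_prob_space "\<lambda>_. ?u" "UNIV :: nat set"
    by (intro product_prob_spaceI prob_space_uniform_measure) (simp_all add: sym_interval_def)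
  have comp: "(\<lambda>f. f i) \<in> seq_measure \<rightarrow>\<^sub>M lborel" for i
    using measurable_seq_coordinate by simp
  have restr: "(\<lambda>f. restrict f {..<m}) \<in> seq_measure \<rightarrow>\<^sub>M ?M"
    by (rule measurable_restrict) (rule comp)
  have setseq: "sets (\<Pi>\<^sub>M i\<in>{..<m}. ?u) = sets ?M" by (intro sets_PiM_cong) auto
  have "distr seq_measure ?M (\<lambda>f. restrict f {..<m}) = (\<Pi>\<^sub>M i\<in>{..<m}. ?u)"
  proof (rule u.PiM_eqI)
    fix B :: "nat \<Rightarrow> real set" assume "\<And>i. i \<in> {..<m} \<Longrightarrow> B i \<in> sets ?u"
    then have B: "B i \<in> sets borel" if "i < m" for i using that by auto
    have box: "Pi\<^sub>E {..<m} B \<in> sets ?M" using B by (intro sets_PiM_I_finite) auto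
    have Bs: "B i \<inter> sym_interval \<in> sets interval_measure" if "i < m" for i
      using B[OF that] by (auto simp: interval_measure_def sets_restrict_space)
    have "emeasure (distr seq_measure ?M (\<lambda>f. restrict f {..<m})) (Pi\<^sub>E {..<m} B)
      = emeasure seq_measure ((\<lambda>f. restrict f {..<m}) -` Pi\<^sub>E {..<m} B \<inter> space seq_measure)"
      by (rule emeasure_distr[OF restr box])
    also have "(\<lambda>f. restrict f {..<m}) -` Pi\<^sub>E {..<m} B \<inter> space seq_measure
      = {f \<in> space seq_measure. \<forall>i\<in>{..<m}. f i \<in> B i \<inter> sym_interval}"
      by (auto simp: space_seq_measure)
    also have "emeasure seq_measure \<dots> = (\<Prod>i\<in>{..<m}. emeasure interval_measure (B i \<inter> sym_interval))"
      unfolding seq_measure_def using Bs by (intro iv.emeasure_PiM_Collect) auto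
    also have "\<dots> = (\<Prod>i\<in>{..<m}. emeasure ?u (B i))"
      by (intro prod.cong refl emeasure_interval_measure B) auto
    finally show "emeasure (distr seq_measure ?M (\<lambda>f. restrict f {..<m})) (Pi\<^sub>E {..<m} B)
      = (\<Prod>i\<in>{..<m}. emeasure ?u (B i))" .
  qed (use setseq in simp_all)
  also have "\<dots> = uniform_measure ?M (cube m)"
  proof (rule u.PiM_eqI[symmetric])
    fix B :: "nat \<Rightarrow> real set" assume "\<And>i. i \<in> {..<m} \<Longrightarrow> B i \<in> sets ?u"
    then have B: "B i \<in> sets borel" if "i < m" for i using that by auto
    have box: "Pi\<^sub>E {..<m} B \<in> sets ?M" using B by (intro sets_PiM_I_finite) auto
    have two: "emeasure lborel sym_interval = 2" by (simp add: sym_interval_def)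
    have "emeasure (uniform_measure ?M (cube m)) (Pi\<^sub>E {..<m} B)
      = emeasure ?M (Pi\<^sub>E {..<m} (\<lambda>i. sym_interval \<inter> B i)) / emeasure ?M (cube m)"
      using box sets_cube by (simp add: cube_def PiE_Int)
    also have "emeasure ?M (Pi\<^sub>E {..<m} (\<lambda>i. sym_interval \<inter> B i)) = (\<Prod>i\<in>{..<m}. emeasure lborel (sym_interval \<inter> B i))"
      using B by (intro lborel_family.emeasure_PiM) auto
    also have "emeasure ?M (cube m) = (\<Prod>i\<in>{..<m}. emeasure lborel sym_interval)"
      unfolding cube_def by (intro lborel_family.emeasure_PiM) auto
    also have "(\<Prod>i\<in>{..<m}. emeasure lborel (sym_interval \<inter> B i)) / (\<Prod>i\<in>{..<m}. emeasure lborel sym_interval)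
      = (\<Prod>i\<in>{..<m}. emeasure lborel (sym_interval \<inter> B i) / emeasure lborel sym_interval)"
      unfolding two divide_ennreal_def prod.distrib
      by (simp add: ennreal_inverse_power)
    also have "\<dots> = (\<Prod>i\<in>{..<m}. emeasure ?u (B i))"
      using B by (intro prod.cong refl) simp
    finally show "emeasure (uniform_measure ?M (cube m)) (Pi\<^sub>E {..<m} B) = (\<Prod>i\<in>{..<m}. emeasure ?u (B i))" .
  qed (use setseq in simp_all)
  finally show ?thesis .
qed

lemma measurable_mpoly_eval_seq [measurable]: "mpoly_eval P \<in> borel_measurable seq_measure"
  by (rule measurable_mpoly_eval) (rule measurable_seq_coordinate)

lemma seq_sublevel_measure_le:
  assumes vars: "mpoly_vars P \<subseteq> {..<m}" and deg: "mpoly_degree P \<le> n" and n: "0 < n"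
    and c: "c \<in> cube m" "1 / 2 < \<bar>mpoly_eval P c\<bar>" and m: "0 < m" and e: "0 < e"
  shows "measure seq_measure {f \<in> space seq_measure. \<bar>mpoly_eval P f\<bar> \<le> e ^ n} \<le> 4 * real m * e"
proof (cases "4 * e < 1")
  case False
  interpret prob_space seq_measure by (rule prob_space_seq_measure)
  \<comment> \<open>Here the asserted bound is at least 1, hence trivial for a probability.\<close>
  have "1 * 1 \<le> real m * (4 * e)" using False m by (intro mult_mono) auto
  then have "1 \<le> 4 * real m * e" by (simp add: mult_ac)
  then show ?thesis by (rule order.trans[OF prob_le_1])
next
  case True
  let ?M = "\<Pi>\<^sub>M i\<in>{..<m}. (lborel :: real measure)"
  interpret prob_space seq_measure by (rule prob_space_seq_measure)
  have [measurable]: "mpoly_eval P \<in> borel_measurable ?M"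
  proof (rule measurable_mpoly_eval)
    fix i assume "i \<in> mpoly_vars P"
    then have "(\<lambda>x. x i) \<in> ?M \<rightarrow>\<^sub>M lborel" using vars by (intro measurable_component_singleton) auto
    then show "(\<lambda>x. x i) \<in> borel_measurable ?M" by simp
  qed
  have restr: "(\<lambda>f. restrict f {..<m}) \<in> seq_measure \<rightarrow>\<^sub>M ?M"
    by (rule measurable_restrict) (simp add: measurable_seq_coordinate)
  let ?S = "{x \<in> space ?M. \<bar>mpoly_eval P x\<bar> \<le> e ^ n}"
  have S: "?S \<in> sets ?M" by measurable
  have V: "emeasure ?M (cube m) = 2 ^ m"
  proof -
    have "emeasure ?M (cube m) = (\<Prod>i\<in>{..<m}. emeasure lborel sym_interval)"
      unfolding cube_def by (intro lborel_family.emeasure_PiM) (auto simp: sym_interval_def)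
    then show ?thesis by (simp add: sym_interval_def)
  qed
  have restrict_eval: "mpoly_eval P (restrict f {..<m}) = mpoly_eval P f" for f
    using vars by (intro mpoly_eval_cong) auto
  have "emeasure seq_measure {f \<in> space seq_measure. \<bar>mpoly_eval P f\<bar> \<le> e ^ n}
      = emeasure (distr seq_measure ?M (\<lambda>f. restrict f {..<m})) ?S"
    unfolding emeasure_distr[OF restr S]
    by (rule arg_cong[where f = "emeasure seq_measure"])
       (auto simp: restrict_eval space_PiM)
  also have "\<dots> = emeasure ?M (cube m \<inter> ?S) / emeasure ?M (cube m)"
    unfolding distr_seq_measure_restrict using S sets_cube by simp
  also have "cube m \<inter> ?S = {x \<in> cube m. \<bar>mpoly_eval P x\<bar> \<le> e ^ n}"
    using sets.sets_into_space[OF sets_cube[of m]] by auto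
  also have "emeasure ?M \<dots> / emeasure ?M (cube m)
      \<le> ennreal (4 * real m * e) * emeasure ?M (cube m) / emeasure ?M (cube m)"
    by (intro divide_right_mono_ennreal cube_sublevel_emeasure_le[OF vars deg n c m e True])
  also have "\<dots> = ennreal (4 * real m * e)"
  proof -
    have "(2 :: ennreal) ^ m / 2 ^ m = 1"
      by (intro ennreal_divide_self) (simp_all add: power_less_top_ennreal)
    then show ?thesis unfolding V by (simp flip: ennreal_times_divide)
  qed
  finally show ?thesis using e by (simp add: emeasure_eq_measure)
qed

text \<open>The coordinate has density 1/2 on [-1,1]; an inequality, since [a,b] may stick out of
  that interval.\<close>

lemma measure_seq_coordinate_Icc_le:
  assumes "a \<le> b"
  shows "measure seq_measure {f \<in> space seq_measure. a \<le> f i \<and> f i \<le> b} \<le> (b - a) / 2"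
proof -
  interpret iv: product_prob_space "\<lambda>_. interval_measure" "UNIV :: nat set"
    by (intro product_prob_spaceI prob_space_interval_measure)
  interpret prob_space seq_measure by (rule prob_space_seq_measure)
  have sym: "sym_interval \<in> sets borel" "emeasure lborel sym_interval = 2"
    by (simp_all add: sym_interval_def)
  have "{f \<in> space seq_measure. a \<le> f i \<and> f i \<le> b}
      = {f \<in> space seq_measure. f i \<in> {a..b} \<inter> sym_interval}"
    by (auto simp: space_seq_measure)
  also have "emeasure seq_measure \<dots> = emeasure interval_measure ({a..b} \<inter> sym_interval)"
    unfolding seq_measure_def
    by (intro iv.emeasure_PiM_Collect_single)
       (auto simp: interval_measure_def sets_restrict_space sym_interval_def)
  also have "\<dots> = emeasure lborel (sym_interval \<inter> {a..b}) / 2"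
    using sym by (simp add: emeasure_interval_measure)
  also have "\<dots> \<le> emeasure lborel {a..b} / 2"
    by (intro divide_right_mono_ennreal emeasure_mono) auto
  also have "\<dots> = ennreal ((b - a) / 2)"
    using assms divide_ennreal[of "b - a" 2] by simp
  finally show ?thesis using assms by (simp add: emeasure_eq_measure)
qed

text \<open>Raising the threshold from \<open>a\<close> to \<open>b\<close> adds at most (b - a)/2
  to the measure of \<open>H\<close>. So this measure is Lipschitz in the threshold; it is 0 at -1,
  where \<open>f 0 = -1\<close> is forced, and that of \<open>G\<close> at 1. The intermediate value
  theorem applies.\<close>

lemma seq_measure_subset_of_measure:
  assumes G: "G \<in> sets seq_measure" and p: "0 \<le> p" "p \<le> measure seq_measure G"
  obtains E where "E \<in> sets seq_measure" "E \<subseteq> G" "measure seq_measure E = p"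
proof -
  interpret prob_space seq_measure by (rule prob_space_seq_measure)
  define H where "H a = G \<inter> {f \<in> space seq_measure. f 0 \<le> a}" for a :: real
  have [measurable]: "(\<lambda>f. f 0) \<in> borel_measurable seq_measure" by (rule measurable_seq_coordinate)
  have H: "H a \<in> sets seq_measure" for a
    unfolding H_def by (intro sets.Int G) measurable
  have step: "prob (H b) - prob (H a) \<le> (b - a) / 2" "prob (H a) \<le> prob (H b)" if "a \<le> b" for a b
  proof -
    have S: "{f \<in> space seq_measure. a \<le> f 0 \<and> f 0 \<le> b} \<in> sets seq_measure" by measurable
    have "prob (H b) \<le> prob (H a \<union> {f \<in> space seq_measure. a \<le> f 0 \<and> f 0 \<le> b})"
      using H S by (intro finite_measure_mono) (auto simp: H_def)
    also have "\<dots> \<le> prob (H a) + prob {f \<in> space seq_measure. a \<le> f 0 \<and> f 0 \<le> b}"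
      using H S by (intro measure_Un_le) auto
    also have "\<dots> \<le> prob (H a) + (b - a) / 2"
      using measure_seq_coordinate_Icc_le[OF that, of 0] by simp
    finally show "prob (H b) - prob (H a) \<le> (b - a) / 2" by linarith
    show "prob (H a) \<le> prob (H b)" using H that by (intro finite_measure_mono) (auto simp: H_def)
  qed
  have "(1 / 2)-lipschitz_on {-1..1} (\<lambda>a. prob (H a))"
  proof (rule lipschitz_onI)
    fix a b :: real
    show "dist (prob (H a)) (prob (H b)) \<le> 1 / 2 * dist a b"
      using step[of a b] step[of b a] by (cases "a \<le> b") (auto simp: dist_real_def)
  qed simp
  then have cont: "continuous_on {-1..1} (\<lambda>a. prob (H a))" by (rule lipschitz_on_continuous_on)
  have "prob (H (- 1)) \<le> prob {f \<in> space seq_measure. - 1 \<le> f 0 \<and> f 0 \<le> - 1}"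
  proof (rule finite_measure_mono)
    show "H (- 1) \<subseteq> {f \<in> space seq_measure. - 1 \<le> f 0 \<and> f 0 \<le> - 1}"
      by (auto simp: H_def space_seq_measure sym_interval_def)
  qed measurable
  then have lo: "prob (H (- 1)) \<le> p" using measure_seq_coordinate_Icc_le[of "-1" "-1" 0] p by simp
  have "H 1 = G"
    using sets.sets_into_space[OF G] by (auto simp: H_def space_seq_measure sym_interval_def)
  then have "\<exists>a\<ge>-1. a \<le> 1 \<and> prob (H a) = p"
    using IVT'[OF lo _ _ cont] p by simp
  then show ?thesis using H that by (auto simp: H_def)
qed

section \<open>The union bound over the family\<close>

lemma normalized_family_degree_0:
  assumes "normalized_family Q m q" "1 \<le> d" "q d = 0"
  shows "1 \<le> \<bar>mpoly_eval (Q d) f\<bar>"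
proof -
  have *: "mpoly_degree (Q d) = 0" "1 \<le> (SUP x\<in>cube (m d). \<bar>mpoly_eval (Q d) x\<bar>)"
    using assms by (auto simp: normalized_family_def)
  have "(\<lambda>i\<in>{..<m d}. 0) \<in> cube (m d)" by (auto simp: cube_def sym_interval_def)
  then have "cube (m d) \<noteq> {}" by blast
  then have "(SUP x\<in>cube (m d). \<bar>mpoly_eval (Q d) f\<bar>) = \<bar>mpoly_eval (Q d) f\<bar>" by simp
  moreover have "(SUP x\<in>cube (m d). \<bar>mpoly_eval (Q d) x\<bar>)
      = (SUP x\<in>cube (m d). \<bar>mpoly_eval (Q d) f\<bar>)"
    by (rule SUP_cong[OF refl], rule arg_cong[where f = abs], rule mpoly_eval_degree_0[OF *(1)])
  ultimately show ?thesis using *(2) by (simp only:)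
qed

lemma normalized_family_large_value:
  assumes "normalized_family Q m q" "1 \<le> d"
  obtains c where "c \<in> cube (m d)" "1 / 2 < \<bar>mpoly_eval (Q d) c\<bar>"
proof -
  have *: "1 \<le> (SUP x\<in>cube (m d). \<bar>mpoly_eval (Q d) x\<bar>)"
    using assms by (auto simp: normalized_family_def)
  have "(\<lambda>i\<in>{..<m d}. 0) \<in> cube (m d)" by (auto simp: cube_def sym_interval_def)
  then have ne: "cube (m d) \<noteq> {}" by blast
  have "\<not> (\<forall>x\<in>cube (m d). \<bar>mpoly_eval (Q d) x\<bar> \<le> 1 / 2)"
  proof
    assume "\<forall>x\<in>cube (m d). \<bar>mpoly_eval (Q d) x\<bar> \<le> 1 / 2"
    then have "(SUP x\<in>cube (m d). \<bar>mpoly_eval (Q d) x\<bar>) \<le> 1 / 2"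
      using ne by (intro cSUP_least) auto
    with * show False by simp
  qed
  then show ?thesis using that by (auto simp: not_le)
qed

lemma normalized_family_lower_bound:
  assumes Q: "normalized_family Q m q" and p: "0 < p" "p < 1"
  shows "\<exists>E\<in>sets seq_measure. measure seq_measure E = p \<and>
    (\<forall>f\<in>E. \<forall>d\<ge>1. (3 * (1 - p) / (2 * pi\<^sup>2 * real d ^ 2 * real (m d))) ^ q d \<le> \<bar>mpoly_eval (Q d) f\<bar>)"
proof -
  interpret prob_space seq_measure by (rule prob_space_seq_measure)
  define e where "e d = 3 * (1 - p) / (2 * pi\<^sup>2 * real d ^ 2 * real (m d))" for d
  \<comment> \<open>The index is shifted by d = j + 1 to match the series of inverse squares.
    Constant polynomials contribute no exceptional set.\<close>
  define B where "B j = (if q (Suc j) = 0 then {} else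
    {f \<in> space seq_measure. \<bar>mpoly_eval (Q (Suc j)) f\<bar> \<le> e (Suc j) ^ q (Suc j)})" for j
  have B: "B j \<in> events" for j
  proof -
    have "{f \<in> space seq_measure. \<bar>mpoly_eval (Q (Suc j)) f\<bar> \<le> e (Suc j) ^ q (Suc j)} \<in> events"
      by measurable
    then show ?thesis by (simp add: B_def)
  qed
  have Ble: "prob (B j) \<le> 6 * (1 - p) / pi\<^sup>2 * (1 / (real j + 1)\<^sup>2)" for j
  proof (cases "q (Suc j) = 0")
    case True
    then show ?thesis using p by (simp add: B_def)
  next
    case False
    let ?d = "Suc j"
    have *: "mpoly_vars (Q ?d) \<subseteq> {..<m ?d}" "mpoly_degree (Q ?d) = q ?d"
      using Q by (auto simp: normalized_family_def)
    \<comment> \<open>Without variables the polynomial would be constant, against q > 0. Positivity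
      of \<open>m\<close> keeps the denominator of \<open>e\<close> away from 0.\<close>
    have m: "0 < m ?d"
      using * False mpoly_degree_eq_0_if_no_vars[of "Q ?d"] by (cases "m ?d = 0") auto
    obtain c where c: "c \<in> cube (m ?d)" "1 / 2 < \<bar>mpoly_eval (Q ?d) c\<bar>"
      using normalized_family_large_value[OF Q, of ?d] by auto
    have "prob (B j) \<le> 4 * real (m ?d) * e ?d"
      using seq_sublevel_measure_le[OF *(1) _ _ c m, of "q ?d" "e ?d"] * False m p
      by (simp add: B_def e_def)
    also have "\<dots> = 6 * (1 - p) / pi\<^sup>2 * (1 / (real j + 1)\<^sup>2)"
      using m by (simp add: e_def field_simps)
    finally show ?thesis .
  qed
  have sums: "(\<lambda>j. 6 * (1 - p) / pi\<^sup>2 * (1 / (real j + 1)\<^sup>2)) sums (1 - p)"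
  proof -
    have "(\<lambda>j. 6 * (1 - p) / pi\<^sup>2 * (1 / (real j + 1)\<^sup>2)) sums (6 * (1 - p) / pi\<^sup>2 * (pi\<^sup>2 / 6))"
      using inverse_squares_sums by (intro sums_mult) (simp add: add.commute)
    also have "6 * (1 - p) / pi\<^sup>2 * (pi\<^sup>2 / 6) = 1 - p" by simp
    finally show ?thesis .
  qed
  have summ: "summable (\<lambda>j. prob (B j))"
    by (rule summable_comparison_test'[OF sums_summable[OF sums], of 0]) (use Ble in simp)
  have "prob (\<Union>j. B j) \<le> suminf (\<lambda>j. prob (B j))"
    using B by (intro finite_measure_subadditive_countably summ) auto
  also have "\<dots> \<le> suminf (\<lambda>j. 6 * (1 - p) / pi\<^sup>2 * (1 / (real j + 1)\<^sup>2))"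
    by (intro suminf_le Ble summ sums_summable[OF sums])
  also have "\<dots> = 1 - p" using sums by (rule sums_unique[symmetric])
  finally have "p \<le> prob (space seq_measure - (\<Union>j. B j))"
    using B by (subst prob_compl) auto
  moreover have "space seq_measure - (\<Union>j. B j) \<in> events" using B by auto
  ultimately obtain E where E: "E \<in> events" "E \<subseteq> space seq_measure - (\<Union>j. B j)" "prob E = p"
    using p by (metis seq_measure_subset_of_measure less_imp_le)
  have "e d ^ q d \<le> \<bar>mpoly_eval (Q d) f\<bar>" if f: "f \<in> E" and d: "1 \<le> d" for f d
  proof (cases "q d = 0")
    case True
    \<comment> \<open>The power is 1 here, also for \<open>m d = 0\<close>, where division by zero
      makes the base 0 and \<open>0 ^ 0 = 1\<close>.\<close>
    then show ?thesis using normalized_family_degree_0[OF Q d] by simp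
  next
    case False
    obtain j where j: "d = Suc j" using d by (cases d) auto
    have "f \<in> space seq_measure" "f \<notin> B j" using E(2) f by auto
    then show ?thesis using False by (simp add: B_def j)
  qed
  then show ?thesis using E by (auto simp: e_def)
qed

section \<open>The exponential form of the bound\<close>

text \<open>The base is exp(-X) with X = a + 2 ln d + ln m, and ln d <= d bounds X by (a + 2 +
  \<kappa>2) d. The constant a + 2 thus collects the logarithm of the numerical factor and the 2
  from d^2. For m = 0 the base would be 0, so m > 0 is required when q > 0.\<close>

lemma exp_le_lower_bound_power:
  assumes p: "0 < p" "p < 1" and d: "1 \<le> d" and k: "0 \<le> \<kappa>1" "0 \<le> \<kappa>2"
    and q: "real q \<le> real d powr \<kappa>1" and m: "real m \<le> real d powr \<kappa>2" "q = 0 \<or> 0 < m"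
  shows "exp (- ((ln (2 * pi\<^sup>2 / (3 * (1 - p))) + 2 + \<kappa>2) * real d powr (\<kappa>1 + 1)))
    \<le> (3 * (1 - p) / (2 * pi\<^sup>2 * real d ^ 2 * real m)) ^ q"
proof -
  define a where "a = ln (2 * pi\<^sup>2 / (3 * (1 - p)))"
  \<comment> \<open>This allows a to be replaced by a d, and the exponent to be seen as nonpositive
    when q = 0.\<close>
  have a: "0 \<le> a"
  proof -
    have "3\<^sup>2 \<le> pi\<^sup>2" using pi_gt3 by (intro power_mono) auto
    then have "1 \<le> 2 * pi\<^sup>2 / (3 * (1 - p))" using p by (simp add: le_divide_eq)
    then show ?thesis by (simp add: a_def)
  qed
  show ?thesis
  proof (cases "q = 0")
    case True
    then show ?thesis unfolding a_def[symmetric] using a k by simp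
  next
    case False
    then have m0: "0 < m" using m by simp
    define X where "X = a + 2 * ln (real d) + ln (real m)"
    have base: "3 * (1 - p) / (2 * pi\<^sup>2 * real d ^ 2 * real m) = exp (- X)"
    proof -
      have "exp X = 2 * pi\<^sup>2 / (3 * (1 - p)) * real d ^ 2 * real m"
        using p d m0 by (simp add: X_def a_def exp_add exp_double power2_eq_square)
      then show ?thesis by (simp add: exp_minus)
    qed
    have lnd: "0 \<le> ln (real d)" "ln (real d) \<le> real d"
      using d ln_le_minus_one[of "real d"] by auto
    have "ln (real m) \<le> ln (real d powr \<kappa>2)"
      using m(1) m0 d by (intro iffD2[OF ln_le_cancel_iff]) auto
    also have "\<dots> = \<kappa>2 * ln (real d)" using d by (simp add: ln_powr)
    also have "\<dots> \<le> \<kappa>2 * real d" using lnd k by (intro mult_left_mono)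
    finally have lnm: "ln (real m) \<le> \<kappa>2 * real d" .
    have "a \<le> a * real d" using a d mult_left_mono[of 1 "real d" a] by simp
    then have X: "X \<le> (a + 2 + \<kappa>2) * real d"
      using lnd lnm by (simp add: X_def algebra_simps)
    have X0: "0 \<le> X" using a lnd m0 by (simp add: X_def)
    have "real q * X \<le> real d powr \<kappa>1 * ((a + 2 + \<kappa>2) * real d)"
      using q X X0 by (intro mult_mono) auto
    also have "\<dots> = (a + 2 + \<kappa>2) * real d powr (\<kappa>1 + 1)"
      using d by (simp add: powr_add)
    finally show ?thesis
      unfolding base a_def[symmetric] by (simp flip: exp_of_nat_mult)
  qed
qed

lemma filterlim_ln_inverse_compl_at_left_1:
  "filterlim (\<lambda>p::real. ln (2 * pi\<^sup>2 / (3 * (1 - p))) + 2) at_top (at_left 1)"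
proof -
  have "filterlim (\<lambda>p::real. 1 - p) (at_right 0) (at_left 1)"
    unfolding filterlim_at
    by (auto intro!: tendsto_eq_intros simp: eventually_at_filter)
  then have "filterlim (\<lambda>p::real. inverse (1 - p)) at_top (at_left 1)"
    by (rule filterlim_compose[OF filterlim_inverse_at_top_right])
  then have "filterlim (\<lambda>p::real. 2 * pi\<^sup>2 / 3 * inverse (1 - p)) at_top (at_left 1)"
    by (rule filterlim_tendsto_pos_mult_at_top[OF tendsto_const, rotated]) simp
  then have "filterlim (\<lambda>p::real. ln (2 * pi\<^sup>2 / 3 * inverse (1 - p))) at_top (at_left 1)"
    by (rule filterlim_compose[OF ln_at_top])
  then have "filterlim (\<lambda>p::real. ln (2 * pi\<^sup>2 / 3 * inverse (1 - p)) + 2) at_top (at_left 1)"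
    by (subst add.commute) (rule filterlim_tendsto_add_at_top[OF tendsto_const])
  moreover have "2 * pi\<^sup>2 / 3 * inverse (1 - p) = 2 * pi\<^sup>2 / (3 * (1 - p))" for p :: real
    by (simp only: inverse_eq_divide times_divide_times_eq mult_1_right)
  ultimately show ?thesis by (simp only:)
qed

theorem theorem4p0p2:
  shows "(\<forall>Q m q (p::real).
            normalized_family Q m q \<longrightarrow> 0 < p \<longrightarrow> p < 1 \<longrightarrow>
            (\<exists>E\<in>sets seq_measure. measure seq_measure E = p \<and>
              (\<forall>f\<in>E. \<forall>d\<ge>1.
                \<bar>mpoly_eval (Q d) f\<bar> \<ge>
                  (3 * (1 - p) / (2 * pi^2 * real d ^ 2 * real (m d))) ^ q d)))
       \<and> (\<exists>\<gamma> :: real \<Rightarrow> real. filterlim \<gamma> at_top (at_left 1) \<and>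
            (\<forall>Q m q (\<kappa>1::real) (\<kappa>2::real) (p::real).
              normalized_family Q m q \<longrightarrow> 0 \<le> \<kappa>1 \<longrightarrow> 0 \<le> \<kappa>2 \<longrightarrow>
              (\<forall>d\<ge>1. real (q d) \<le> real d powr \<kappa>1) \<longrightarrow>
              (\<forall>d\<ge>1. real (m d) \<le> real d powr \<kappa>2) \<longrightarrow>
              0 < p \<longrightarrow> p < 1 \<longrightarrow>
              (let A = {f \<in> space seq_measure. \<forall>d\<ge>1.
                     \<bar>mpoly_eval (Q d) f\<bar> \<ge>
                       exp (- ((\<gamma> p + \<kappa>2) * real d powr (\<kappa>1 + 1)))}
               in A \<in> sets seq_measure \<and> measure seq_measure A \<ge> p)))"

proof (intro conjI exI[where x = "\<lambda>p. ln (2 * pi\<^sup>2 / (3 * (1 - p))) + 2"])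
  show "\<forall>Q m q (p::real). normalized_family Q m q \<longrightarrow> 0 < p \<longrightarrow> p < 1 \<longrightarrow>
      (\<exists>E\<in>sets seq_measure. measure seq_measure E = p \<and>
        (\<forall>f\<in>E. \<forall>d\<ge>1. \<bar>mpoly_eval (Q d) f\<bar> \<ge> (3 * (1 - p) / (2 * pi^2 * real d ^ 2 * real (m d))) ^ q d))"
    using normalized_family_lower_bound by blast
  show "filterlim (\<lambda>p::real. ln (2 * pi\<^sup>2 / (3 * (1 - p))) + 2) at_top (at_left 1)"
    by (rule filterlim_ln_inverse_compl_at_left_1)
  show "\<forall>Q m q (\<kappa>1::real) (\<kappa>2::real) (p::real).
      normalized_family Q m q \<longrightarrow> 0 \<le> \<kappa>1 \<longrightarrow> 0 \<le> \<kappa>2 \<longrightarrow>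
      (\<forall>d\<ge>1. real (q d) \<le> real d powr \<kappa>1) \<longrightarrow> (\<forall>d\<ge>1. real (m d) \<le> real d powr \<kappa>2) \<longrightarrow>
      0 < p \<longrightarrow> p < 1 \<longrightarrow>
      (let A = {f \<in> space seq_measure. \<forall>d\<ge>1. \<bar>mpoly_eval (Q d) f\<bar> \<ge>
             exp (- ((ln (2 * pi\<^sup>2 / (3 * (1 - p))) + 2 + \<kappa>2) * real d powr (\<kappa>1 + 1)))}
       in A \<in> sets seq_measure \<and> measure seq_measure A \<ge> p)"
  proof (intro allI impI)
    fix Q m q and \<kappa>1 \<kappa>2 p :: real
    assume Q: "normalized_family Q m q" and k: "0 \<le> \<kappa>1" "0 \<le> \<kappa>2"
      and qd: "\<forall>d\<ge>1. real (q d) \<le> real d powr \<kappa>1" and md: "\<forall>d\<ge>1. real (m d) \<le> real d powr \<kappa>2"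
      and p: "0 < p" "p < 1"
    interpret prob_space seq_measure by (rule prob_space_seq_measure)
    define A where "A = {f \<in> space seq_measure. \<forall>d\<ge>1. \<bar>mpoly_eval (Q d) f\<bar> \<ge>
      exp (- ((ln (2 * pi\<^sup>2 / (3 * (1 - p))) + 2 + \<kappa>2) * real d powr (\<kappa>1 + 1)))}"
    have A: "A \<in> events" unfolding A_def by measurable
    obtain E where E: "E \<in> events" "prob E = p" and Ed: "\<And>f d. f \<in> E \<Longrightarrow> 1 \<le> d \<Longrightarrow>
        (3 * (1 - p) / (2 * pi\<^sup>2 * real d ^ 2 * real (m d))) ^ q d \<le> \<bar>mpoly_eval (Q d) f\<bar>"
      using normalized_family_lower_bound[OF Q p] by blast
    have "q d = 0 \<or> 0 < m d" if "1 \<le> d" for d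
      using Q that mpoly_degree_eq_0_if_no_vars[of "Q d"]
      by (cases "m d = 0") (auto simp: normalized_family_def)
    then have "exp (- ((ln (2 * pi\<^sup>2 / (3 * (1 - p))) + 2 + \<kappa>2) * real d powr (\<kappa>1 + 1)))
        \<le> \<bar>mpoly_eval (Q d) f\<bar>" if "f \<in> E" "1 \<le> d" for f d
      using exp_le_lower_bound_power[OF p that(2) k] qd md Ed[OF that] that(2) order.trans by blast
    \<comment> \<open>The set of measure exactly \<open>p\<close> from the first part lies in
      \<open>A\<close>, so \<open>A\<close> has measure at least \<open>p\<close>.\<close>
    then have "E \<subseteq> A" using sets.sets_into_space[OF E(1)] by (auto simp: A_def)
    then have "p \<le> prob A" using finite_measure_mono[OF _ A] E(2) by metis
    then show "let A = {f \<in> space seq_measure. \<forall>d\<ge>1. \<bar>mpoly_eval (Q d) f\<bar> \<ge>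
        exp (- ((ln (2 * pi\<^sup>2 / (3 * (1 - p))) + 2 + \<kappa>2) * real d powr (\<kappa>1 + 1)))}
      in A \<in> events \<and> p \<le> prob A"
      using A by (simp add: A_def)
  qed
qed

end
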